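(* Let $K\ge 2$, $\sigma^2>0$, and consider any $K$-armed bandit instance with $\sigma^2$-sub-Gaussian reward noise. Then Maillard Sampling (MS) run with inputs $K$ and $\sigma^2$ satisfies, for every $T\ge 1$ and every $c>0$, $$\mathbb{E}\,\mathsf{Reg}_T\;\le\;\sum_{a\in[K]:\,\Delta_a>0}\left(\frac{2\sigma^2(1+c)^2\ln\!\left(\frac{T\Delta_a^2}{\sigma^2}\right)}{\Delta_a}+O\!\left(\max\left\{\Delta_a,\ \frac{(1+c)^2\sigma^2}{c^2\Delta_a}\ln\!\left(\frac{(1+c)^2\sigma^2}{c^2\Delta_a^2}\right)\right\}\right)\right),$$ where $O(\cdot)$ hides a universal multiplicative constant.
   Context: **Bandit problem.** There are $K$ arms, $[K]=\{1,\dots,K\}$. Arm $i$ has a reward distribution $\nu_i$ on $\mathbb{R}$ with unknown mean $\mu_i\in\mathbb{R}$, and $\nu_i$ is $\sigma^2$-sub-Gaussian: if $y\sim\nu_i$ then $\mathbb{E}[\exp(\lambda(y-\mu_i))]\le\exp(\lambda^2\sigma^2/2)$ for all $\lambda\in\mathbb{R}$. At each time $t=1,2,\dots$ the learner chooses an arm $I_t\in[K]$ (possibly at random, based on past arms and rewards), then receives a reward $y_t$ drawn from $\nu_{I_t}$, independently of the past given $I_t$. The algorithm knows $\sigma^2$. **Gaps and regret.** $\Delta_a:=\max_{b\in[K]}\mu_b-\mu_a$. For an integer time horizon $T\ge1$, the (pseudo-)regret is $\mathsf{Reg}_T=\sum_{t=1}^T\left(\max_{a\in[K]}\mu_a-\mu_{I_t}\right)$.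 **Empirical quantities.** $N_{t,a}$ is the number of times arm $a$ has been pulled up to and including time $t$; $\hat\mu_{t,a}$ is the average of the rewards obtained from arm $a$ up to and including time $t$; $\hat\Delta_{t,a}:=\max_{b}\hat\mu_{t,b}-\hat\mu_{t,a}$. **Maillard Sampling (MS).** Input: $K\ge2$, $\sigma^2>0$. For $t\le K$: pull arm $I_t=t$. For $t>K$: draw $I_t$ (conditionally on the past) from the distribution $p_t$ on $[K]$ with $$p_{t,a}\propto\exp\!\left(-\frac{1}{2\sigma^2}N_{t-1,a}\hat\Delta_{t-1,a}^2\right).$$
   Formalization: In the leading term, ln(TΔ_a²/σ²) is replaced by its positive part max(0, ln(TΔ_a²/σ²)); as written the bound fails for TΔ_a² < σ² and large c, since its right-hand side tends to minus infinity while the expected regret is nonnegative. *)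

theory Defs
  imports "HOL-Probability.Probability"
begin

section \<open>Trajectories and empirical quantities\<close>

text \<open>Arms are \<open>1, \<dots>, K\<close> and rounds are \<open>t = 1, 2, \<dots>\<close>.  A trajectory
  \<open>\<omega> :: nat \<Rightarrow> nat \<times> real\<close> stores the arm pulled and the reward received in round \<open>t\<close>
  at position \<open>t - 1\<close>, so that the history of the rounds before \<open>t = Suc n\<close> consists of
  the coordinates in \<open>{0..<n}\<close>.\<close>

type_synonym trajectory = "nat \<Rightarrow> nat \<times> real"

definition pulled_arm :: "trajectory \<Rightarrow> nat \<Rightarrow> nat" where
  "pulled_arm \<omega> t = fst (\<omega> (t - 1))"

definition reward :: "trajectory \<Rightarrow> nat \<Rightarrow> real" where
  "reward \<omega> t = snd (\<omega> (t - 1))"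

definition pull_count :: "trajectory \<Rightarrow> nat \<Rightarrow> nat \<Rightarrow> nat" where
  "pull_count \<omega> t a = card {s \<in> {1..t}. pulled_arm \<omega> s = a}"

definition emp_mean :: "trajectory \<Rightarrow> nat \<Rightarrow> nat \<Rightarrow> real" where
  "emp_mean \<omega> t a =
     (\<Sum>s \<in> {s \<in> {1..t}. pulled_arm \<omega> s = a}. reward \<omega> s) / real (pull_count \<omega> t a)"

definition emp_gap :: "nat \<Rightarrow> trajectory \<Rightarrow> nat \<Rightarrow> nat \<Rightarrow> real" where
  "emp_gap K \<omega> t a = (MAX b\<in>{1..K}. emp_mean \<omega> t b) - emp_mean \<omega> t a"

section \<open>Bandit instances, gaps and regret\<close>

definition arm_mean :: "(nat \<Rightarrow> real measure) \<Rightarrow> nat \<Rightarrow> real" where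
  "arm_mean \<nu> a = (\<integral>y. y \<partial>\<nu> a)"

text \<open>The Bochner integral of a non-integrable function is \<open>0\<close>; the integrability conditions
  state that the mean and the moment generating function are genuinely finite.\<close>

definition sub_gaussian :: "real \<Rightarrow> real measure \<Rightarrow> bool" where
  "sub_gaussian \<sigma> N \<longleftrightarrow>
     prob_space N \<and> sets N = sets borel \<and> integrable N (\<lambda>y. y) \<and>
     (\<forall>l::real. integrable N (\<lambda>y. exp (l * (y - (\<integral>z. z \<partial>N)))) \<and>
        (\<integral>y. exp (l * (y - (\<integral>z. z \<partial>N))) \<partial>N) \<le> exp (l\<^sup>2 * \<sigma>\<^sup>2 / 2))"

definition gap :: "nat \<Rightarrow> (nat \<Rightarrow> real measure) \<Rightarrow> nat \<Rightarrow> real" where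
  "gap K \<nu> a = (MAX b\<in>{1..K}. arm_mean \<nu> b) - arm_mean \<nu> a"

definition regret :: "nat \<Rightarrow> (nat \<Rightarrow> real measure) \<Rightarrow> nat \<Rightarrow> trajectory \<Rightarrow> real" where
  "regret K \<nu> T \<omega> =
     (\<Sum>t = 1..T. (MAX b\<in>{1..K}. arm_mean \<nu> b) - arm_mean \<nu> (pulled_arm \<omega> t))"

section \<open>Interaction of a policy with a bandit instance\<close>

text \<open>A policy \<open>\<pi>\<close> gives the probability \<open>\<pi> t \<omega> a\<close> of pulling arm \<open>a\<close> in round \<open>t\<close>; it is meant
  to depend on \<open>\<omega>\<close> only through the rounds before \<open>t\<close>.\<close>

type_synonym policy = "nat \<Rightarrow> trajectory \<Rightarrow> nat \<Rightarrow> real"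

definition round_space :: "nat \<Rightarrow> (nat \<times> real) measure" where
  "round_space K = count_space {1..K} \<Otimes>\<^sub>M borel"

text \<open>Conditional law of arm and reward in round \<open>Suc n\<close> given the past: draw the arm \<open>a\<close>
  according to \<open>\<pi>\<close>, then the reward from \<open>\<nu> a\<close>.\<close>

definition round_kernel ::
  "nat \<Rightarrow> (nat \<Rightarrow> real measure) \<Rightarrow> policy \<Rightarrow> nat \<Rightarrow> trajectory \<Rightarrow> (nat \<times> real) measure" where
  "round_kernel K \<nu> \<pi> n \<omega> =
     point_measure {1..K} (\<lambda>a. ennreal (\<pi> (Suc n) \<omega> a)) \<bind>
       (\<lambda>a. distr (\<nu> a) (round_space K) (\<lambda>y. (a, y)))"

text \<open>Law of the infinite trajectory generated by these kernels (Ionescu-Tulcea).\<close>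

definition bandit_law ::
  "nat \<Rightarrow> (nat \<Rightarrow> real measure) \<Rightarrow> policy \<Rightarrow> trajectory measure" where
  "bandit_law K \<nu> \<pi> =
     projective_family.lim UNIV
       (Ionescu_Tulcea.CI (round_kernel K \<nu> \<pi>) (\<lambda>_. round_space K)) (\<lambda>_. round_space K)"

section \<open>Maillard Sampling\<close>

definition ms_weight :: "nat \<Rightarrow> real \<Rightarrow> trajectory \<Rightarrow> nat \<Rightarrow> nat \<Rightarrow> real" where
  "ms_weight K \<sigma> \<omega> t a =
     exp (- (1 / (2 * \<sigma>\<^sup>2)) * real (pull_count \<omega> t a) * (emp_gap K \<omega> t a)\<^sup>2)"

definition maillard_sampling :: "nat \<Rightarrow> real \<Rightarrow> policy" where
  "maillard_sampling K \<sigma> t \<omega> a =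
     (if t \<le> K then (if a = t then 1 else 0)
      else ms_weight K \<sigma> \<omega> (t - 1) a / (\<Sum>b\<in>{1..K}. ms_weight K \<sigma> \<omega> (t - 1) b))"

section \<open>Well-definedness of the interaction\<close>

lemma maillard_sampling_nonneg: "maillard_sampling K \<sigma> t \<omega> a \<ge> 0"
  by (auto simp: maillard_sampling_def ms_weight_def intro!: divide_nonneg_nonneg sum_nonneg)

lemma maillard_sampling_sum:
  assumes "K \<ge> 1" "t \<ge> 1"
  shows "(\<Sum>a\<in>{1..K}. maillard_sampling K \<sigma> t \<omega> a) = 1"
proof (cases "t \<le> K")
  case True
  then show ?thesis using assms by (simp add: maillard_sampling_def)
next
  case False
  have "(\<Sum>b\<in>{1..K}. ms_weight K \<sigma> \<omega> (t - 1) b) > 0"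
    using assms by (intro sum_pos) (auto simp: ms_weight_def)
  then show ?thesis
    using False by (simp add: maillard_sampling_def flip: sum_divide_distrib)
qed

context
  fixes K n :: nat
begin

lemma measurable_pulled_arm:
  assumes "s \<in> {1..n}"
  shows "(\<lambda>\<omega>. pulled_arm \<omega> s) \<in> measurable (PiM {0..<n} (\<lambda>_. round_space K)) (count_space {1..K})"
proof -
  have "s - 1 \<in> {0..<n}" using assms by auto
  then have "(\<lambda>\<omega>. \<omega> (s - 1)) \<in> measurable (PiM {0..<n} (\<lambda>_. round_space K)) (round_space K)"
    by (rule measurable_component_singleton)
  from measurable_compose[OF this[unfolded round_space_def] measurable_fst]
  show ?thesis by (simp add: pulled_arm_def round_space_def)
qed

lemma measurable_reward:
  assumes "s \<in> {1..n}"
  shows "(\<lambda>\<omega>. reward \<omega> s) \<in> borel_measurable (PiM {0..<n} (\<lambda>_. round_space K))"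
proof -
  have "s - 1 \<in> {0..<n}" using assms by auto
  then have "(\<lambda>\<omega>. \<omega> (s - 1)) \<in> measurable (PiM {0..<n} (\<lambda>_. round_space K)) (round_space K)"
    by (rule measurable_component_singleton)
  from measurable_compose[OF this[unfolded round_space_def] measurable_snd]
  show ?thesis by (simp add: reward_def round_space_def)
qed

lemma measurable_if_pulled:
  fixes f g :: "trajectory \<Rightarrow> real"
  assumes s: "s \<in> {1..n}"
    and "f \<in> borel_measurable (PiM {0..<n} (\<lambda>_. round_space K))"
    and "g \<in> borel_measurable (PiM {0..<n} (\<lambda>_. round_space K))"
  shows "(\<lambda>\<omega>. if pulled_arm \<omega> s = a then f \<omega> else g \<omega>)
           \<in> borel_measurable (PiM {0..<n} (\<lambda>_. round_space K))"
proof -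
  have "Measurable.pred (PiM {0..<n} (\<lambda>_. round_space K)) (\<lambda>\<omega>. pulled_arm \<omega> s = a)"
    using measurable_compose[OF measurable_pulled_arm[OF s], of "\<lambda>x. x = a" "count_space UNIV"] by simp
  then show ?thesis using assms by (intro measurable_If) (auto simp: pred_def)
qed

lemma measurable_pull_count:
  "(\<lambda>\<omega>. real (pull_count \<omega> n a)) \<in> borel_measurable (PiM {0..<n} (\<lambda>_. round_space K))"
proof -
  have eq: "real (pull_count \<omega> n a) = (\<Sum>s\<in>{1..n}. if pulled_arm \<omega> s = a then 1 else 0)" for \<omega>
    unfolding pull_count_def by (subst sum.inter_filter[symmetric]) auto
  show ?thesis
    unfolding eq by (intro borel_measurable_sum measurable_if_pulled borel_measurable_const)
qed

lemma measurable_emp_mean: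
  "(\<lambda>\<omega>. emp_mean \<omega> n a) \<in> borel_measurable (PiM {0..<n} (\<lambda>_. round_space K))"
proof -
  have eq: "emp_mean \<omega> n a =
      (\<Sum>s\<in>{1..n}. if pulled_arm \<omega> s = a then reward \<omega> s else 0) / real (pull_count \<omega> n a)" for \<omega>
    unfolding emp_mean_def by (subst sum.inter_filter) auto
  show ?thesis
    unfolding eq
    by (intro borel_measurable_divide borel_measurable_sum measurable_if_pulled
        borel_measurable_const measurable_reward measurable_pull_count)
qed

lemma measurable_maillard_sampling:
  assumes "K \<ge> 1"
  shows "(\<lambda>\<omega>. maillard_sampling K \<sigma> (Suc n) \<omega> a)
           \<in> borel_measurable (PiM {0..<n} (\<lambda>_. round_space K))"
proof -
  note [measurable] = measurable_emp_mean measurable_pull_count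
  have [measurable]: "(\<lambda>\<omega>. emp_gap K \<omega> n b) \<in> borel_measurable (PiM {0..<n} (\<lambda>_. round_space K))" for b
    unfolding emp_gap_def
    by (intro borel_measurable_diff borel_measurable_Max measurable_emp_mean) auto
  have [measurable]: "(\<lambda>\<omega>. ms_weight K \<sigma> \<omega> n b) \<in> borel_measurable (PiM {0..<n} (\<lambda>_. round_space K))" for b
    unfolding ms_weight_def by measurable
  show ?thesis
  proof (cases "Suc n \<le> K")
    case True
    then show ?thesis by (simp only: maillard_sampling_def if_True borel_measurable_const)
  next
    case False
    then show ?thesis
      by (simp only: maillard_sampling_def if_False diff_Suc_1)
        (intro borel_measurable_divide borel_measurable_sum, measurable)
  qed
qed

end

lemma Ionescu_Tulcea_maillard_sampling:
  assumes K: "K \<ge> 1" and \<nu>: "\<And>a. a \<in> {1..K} \<Longrightarrow> prob_space (\<nu> a) \<and> sets (\<nu> a) = sets borel"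
  shows "Ionescu_Tulcea (round_kernel K \<nu> (maillard_sampling K \<sigma>)) (\<lambda>_. round_space K)"
proof (rule Ionescu_Tulcea.intro)
  let ?p = "\<lambda>n \<omega>. point_measure {1..K} (\<lambda>a. ennreal (maillard_sampling K \<sigma> (Suc n) \<omega> a))"
  have sp: "prob_space (?p n \<omega>)" for n \<omega>
  proof
    show "emeasure (?p n \<omega>) (space (?p n \<omega>)) = 1"
      using maillard_sampling_sum[OF K, of "Suc n" \<sigma> \<omega>]
      by (simp add: space_point_measure emeasure_point_measure_finite sum_ennreal
          maillard_sampling_nonneg)
  qed
  have pm: "?p n \<in> measurable (PiM {0..<n} (\<lambda>_. round_space K)) (subprob_algebra (count_space {1..K}))" for n
  proof (rule measurable_subprob_algebra)
    show "subprob_space (?p n \<omega>)" for \<omega> by (rule prob_space_imp_subprob_space[OF sp])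
    show "sets (?p n \<omega>) = sets (count_space {1..K})" for \<omega> by (simp add: sets_point_measure)
    fix A assume "A \<in> sets (count_space {1..K})"
    then have A: "A \<subseteq> {1..K}" by simp
    have "(\<lambda>\<omega>. \<Sum>a\<in>A. ennreal (maillard_sampling K \<sigma> (Suc n) \<omega> a))
            \<in> borel_measurable (PiM {0..<n} (\<lambda>_. round_space K))"
      by (intro borel_measurable_sum measurable_compose[OF measurable_maillard_sampling[OF K]]) simp
    then show "(\<lambda>\<omega>. emeasure (?p n \<omega>) A) \<in> borel_measurable (PiM {0..<n} (\<lambda>_. round_space K))"
      using A by (simp add: emeasure_point_measure_finite)
  qed
  have mp: "(\<lambda>y. (a, y)) \<in> measurable (\<nu> a) (round_space K)" if "a \<in> {1..K}" for a
  proof -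
    have "(\<lambda>y. (a, y)) \<in> measurable borel (round_space K)"
      using that unfolding round_space_def by (intro measurable_Pair1') simp
    then show ?thesis using \<nu>[OF that] by (simp cong: measurable_cong_sets)
  qed
  have dp: "prob_space (distr (\<nu> a) (round_space K) (\<lambda>y. (a, y)))" if "a \<in> {1..K}" for a
    using \<nu>[OF that] mp[OF that] by (intro prob_space.prob_space_distr) auto
  have dm: "(\<lambda>a. distr (\<nu> a) (round_space K) (\<lambda>y. (a, y)))
      \<in> measurable (count_space {1..K}) (subprob_algebra (round_space K))"
    using dp by (auto simp: space_subprob_algebra intro!: prob_space_imp_subprob_space)
  show "round_kernel K \<nu> (maillard_sampling K \<sigma>) n
      \<in> measurable (PiM {0..<n} (\<lambda>_. round_space K)) (subprob_algebra (round_space K))" for n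
    unfolding round_kernel_def[abs_def] by (rule measurable_bind2[OF pm dm])
  show "prob_space (round_kernel K \<nu> (maillard_sampling K \<sigma>) n \<omega>)" for n \<omega>
    unfolding round_kernel_def
  proof (rule prob_space.prob_space_bind[OF sp, where S = "round_space K"])
    show "AE a in ?p n \<omega>. prob_space (distr (\<nu> a) (round_space K) (\<lambda>y. (a, y)))"
      using dp by (intro AE_I2) (simp add: space_point_measure)
    show "(\<lambda>a. distr (\<nu> a) (round_space K) (\<lambda>y. (a, y))) \<in> measurable (?p n \<omega>) (subprob_algebra (round_space K))"
      using dm by (simp cong: measurable_cong_sets add: sets_point_measure)
  qed
qed

lemma prob_space_bandit_law:
  assumes "K \<ge> 1" "\<And>a. a \<in> {1..K} \<Longrightarrow> sub_gaussian \<sigma> (\<nu> a)"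
  shows "prob_space (bandit_law K \<nu> (maillard_sampling K \<sigma>))"
    and "sets (bandit_law K \<nu> (maillard_sampling K \<sigma>)) = sets (PiM UNIV (\<lambda>_. round_space K))"
proof -
  interpret Ionescu_Tulcea "round_kernel K \<nu> (maillard_sampling K \<sigma>)" "\<lambda>_. round_space K"
    using assms by (intro Ionescu_Tulcea_maillard_sampling) (auto simp: sub_gaussian_def)
  have *: "PF.emb UNIV {} (space (PiM {} (\<lambda>_. round_space K))) = space (PiM UNIV (\<lambda>_. round_space K))"
    by (auto simp: prod_emb_def space_PiM)
  interpret CI: prob_space "CI {}" by (rule PF.prob_space_P) auto
  show s: "sets (bandit_law K \<nu> (maillard_sampling K \<sigma>)) = sets (PiM UNIV (\<lambda>_. round_space K))"
    unfolding bandit_law_def by (rule PF.sets_lim)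
  have "emeasure PF.lim (space (PiM UNIV (\<lambda>_. round_space K))) = 1"
    using lim[of "{}" "space (PiM {} (\<lambda>_. round_space K))"] CI.emeasure_space_1
    unfolding * by (simp add: PF.space_P)
  then show "prob_space (bandit_law K \<nu> (maillard_sampling K \<sigma>))"
    using sets_eq_imp_space_eq[OF s] by (intro prob_spaceI) (simp add: bandit_law_def)
qed

lemma integrable_regret:
  assumes "K \<ge> 1" "\<And>a. a \<in> {1..K} \<Longrightarrow> sub_gaussian \<sigma> (\<nu> a)"
  shows "integrable (bandit_law K \<nu> (maillard_sampling K \<sigma>)) (regret K \<nu> T)"
proof -
  interpret prob_space "bandit_law K \<nu> (maillard_sampling K \<sigma>)"
    by (rule prob_space_bandit_law(1)[OF assms])
  note S = prob_space_bandit_law(2)[OF assms]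
  have "integrable (bandit_law K \<nu> (maillard_sampling K \<sigma>)) (\<lambda>\<omega>. arm_mean \<nu> (pulled_arm \<omega> t))" for t
  proof (rule integrable_const_bound)
    have c: "(\<lambda>\<omega>. \<omega> (t - 1)) \<in> measurable (PiM UNIV (\<lambda>_. round_space K)) (round_space K)"
      by (rule measurable_component_singleton) simp
    from measurable_compose[OF this[unfolded round_space_def] measurable_fst]
    have a: "(\<lambda>\<omega>. pulled_arm \<omega> t) \<in> measurable (PiM UNIV (\<lambda>_. round_space K)) (count_space {1..K})"
      by (simp add: pulled_arm_def round_space_def)
    have "(\<lambda>\<omega>. arm_mean \<nu> (pulled_arm \<omega> t)) \<in> borel_measurable (PiM UNIV (\<lambda>_. round_space K))"
      by (rule measurable_compose[OF a]) simp
    then show "(\<lambda>\<omega>. arm_mean \<nu> (pulled_arm \<omega> t)) \<in> borel_measurable (bandit_law K \<nu> (maillard_sampling K \<sigma>))"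
      using S by (simp cong: measurable_cong_sets)
    show "AE \<omega> in bandit_law K \<nu> (maillard_sampling K \<sigma>).
        norm (arm_mean \<nu> (pulled_arm \<omega> t)) \<le> (\<Sum>b\<in>{1..K}. \<bar>arm_mean \<nu> b\<bar>)"
    proof (rule AE_I2)
      fix \<omega> assume "\<omega> \<in> space (bandit_law K \<nu> (maillard_sampling K \<sigma>))"
      then have "pulled_arm \<omega> t \<in> {1..K}"
        using measurable_space[OF a] sets_eq_imp_space_eq[OF S] by simp
      then show "norm (arm_mean \<nu> (pulled_arm \<omega> t)) \<le> (\<Sum>b\<in>{1..K}. \<bar>arm_mean \<nu> b\<bar>)"
        by (simp only: real_norm_def) (rule member_le_sum, auto)
    qed
  qed
  then show ?thesis
    unfolding regret_def[abs_def] by (intro Bochner_Integration.integrable_sum) auto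
qed

end

theory Submission
  imports Defs
begin

text \<open>Fix a suboptimal arm \<open>a\<close> with gap \<open>\<Delta>\<close>, an optimal arm \<open>b\<close>, and write
  \<open>\<Delta> = d + 2 \<epsilon>\<close> with \<open>d = \<Delta> / (1 + c)\<close>.  Apart from the first \<open>u \<approx> 2 \<sigma>\<^sup>2 ln (T \<Delta>\<^sup>2 / \<sigma>\<^sup>2) / d\<^sup>2\<close>
  pulls, a pull of \<open>a\<close> falls into one of three cases.  If the empirical gap of \<open>a\<close> is at least \<open>d\<close>, its
  sampling probability is at most \<open>\<sigma>\<^sup>2 / (T \<Delta>\<^sup>2)\<close>.  If the empirical mean of \<open>a\<close> is too large by
  \<open>\<epsilon>\<close>, Chernoff bounds sum to \<open>O(\<sigma>\<^sup>2 / \<epsilon>\<^sup>2)\<close>.  Otherwise all empirical means are at most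
  \<open>\<mu>\<^sub>b - \<epsilon>\<close>; then the probability of \<open>a\<close> is at most the reciprocal weight of \<open>b\<close> times the
  probability of \<open>b\<close>, so pulls of \<open>a\<close> are paid for by pulls of \<open>b\<close> weighted with
  \<open>exp (m y\<^sup>2 / (2 \<sigma>\<^sup>2))\<close>, where \<open>m\<close> counts the earlier pulls of \<open>b\<close> and \<open>y\<close> is the shortfall of
  its empirical mean below \<open>\<mu>\<^sub>b - \<epsilon>\<close>.  Both deviation terms are indexed by the pull count
  \<open>m\<close> instead of time, which the exponential supermartingale stopped at the \<open>m\<close>-th pull makes
  possible under adaptive sampling.\<close>

section \<open>Exponential sums\<close>

text \<open>Both bounds come from \<open>exp q - 1 \<ge> q\<close>. The second keeps the factor
  \<open>exp q\<close>, which is absorbed by a decaying prefactor in the layer sum below.\<close>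

lemma inverse_one_minus_exp_le:
  fixes q :: real
  assumes "q > 0"
  shows "1 / (1 - exp (- q)) \<le> 1 + 1 / q" "1 / (1 - exp (- q)) \<le> exp q / q"
proof -
  have "exp q > 1 + q \<or> exp q = 1 + q" using exp_ge_add_one_self[of q] by linarith
  then have e: "exp q - 1 \<ge> q" by auto
  have eq: "1 / (1 - exp (- q)) = exp q / (exp q - 1)"
    using assms by (simp add: exp_minus field_simps)
  also have "\<dots> = 1 + 1 / (exp q - 1)"
    using e assms by (simp add: field_simps)
  also have "\<dots> \<le> 1 + 1 / q"
    using e assms by (intro add_left_mono divide_left_mono) auto
  finally show "1 / (1 - exp (- q)) \<le> 1 + 1 / q" .
  show "1 / (1 - exp (- q)) \<le> exp q / q"
    unfolding eq using e assms by (intro divide_left_mono) auto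
qed

lemma sum_exp_geometric_le:
  fixes q :: real
  assumes "q > 0"
  shows "(\<Sum>m<T. exp (- (q * real m))) \<le> 1 + 1 / q"
proof -
  let ?r = "exp (- q)"
  have r: "0 < ?r" "?r < 1" using assms by auto
  have "(\<Sum>m<T. exp (- (q * real m))) = (\<Sum>m<T. ?r ^ m)"
    by (simp add: exp_of_nat_mult[symmetric] mult.commute)
  also have "\<dots> \<le> (\<Sum>m. ?r ^ m)"
    using r by (intro sum_le_suminf summable_geometric) auto
  also have "\<dots> = 1 / (1 - ?r)"
    using r by (intro suminf_geometric) auto
  also note inverse_one_minus_exp_le(1)[OF assms]
  finally show ?thesis .
qed

text \<open>This is the Mercator series of \<open>- ln (1 - exp (- q))\<close>, cut off at
  \<open>T\<close>. It is the source of the logarithm in the lower-order regret term.\<close>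

lemma sum_exp_over_le:
  fixes q :: real
  assumes "q > 0"
  shows "(\<Sum>m\<in>{1..<T}. exp (- (q * real m)) / real m) \<le> ln (1 + 1 / q)"
proof -
  let ?r = "exp (- q)"
  have r: "0 < ?r" "?r < 1" using assms by auto
  from ln_series'[of "- ?r"] have "(\<lambda>m. - (?r ^ m / real m)) sums ln (1 - ?r)"
    using r by simp
  from sums_minus[OF this] have S: "(\<lambda>m. ?r ^ m / real m) sums (- ln (1 - ?r))" by simp
  have "(\<Sum>m\<in>{1..<T}. exp (- (q * real m)) / real m) = (\<Sum>m\<in>{1..<T}. ?r ^ m / real m)"
    by (simp add: exp_of_nat_mult[symmetric] mult.commute)
  also have "\<dots> \<le> (\<Sum>m. ?r ^ m / real m)"
    using S r by (intro sum_le_suminf) (auto simp: sums_iff)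
  also have "\<dots> = ln (1 / (1 - ?r))"
    using S r by (simp add: sums_iff ln_div)
  also have "\<dots> \<le> ln (1 + 1 / q)"
    using inverse_one_minus_exp_le(1)[OF assms] r assms by (subst ln_le_cancel_iff) (auto intro: add_pos_pos)
  finally show ?thesis .
qed

text \<open>A geometric series with ratio \<open>exp (- (2 * q))\<close>. It gives the total weight
  of the layers below, where \<open>q\<close> is proportional to the pull count.\<close>

lemma suminf_layer_weights_le:
  fixes q :: real
  assumes "q > 0"
  shows "(\<Sum>k. ennreal (exp (- (real (2 * k + 3) * q)))) \<le> ennreal (exp (- q) / (2 * q))"
proof -
  let ?r = "exp (- (2 * q))"
  have r: "0 < ?r" "?r < 1" using assms by auto
  have eq: "exp (- (real (2 * k + 3) * q)) = exp (- (3 * q)) * ?r ^ k" for k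
    by (simp add: exp_of_nat_mult[symmetric] exp_add[symmetric] algebra_simps)
  have "(\<lambda>k. exp (- (real (2 * k + 3) * q))) sums (exp (- (3 * q)) * (1 / (1 - ?r)))"
    unfolding eq using r by (intro sums_mult geometric_sums) auto
  then have "(\<Sum>k. ennreal (exp (- (real (2 * k + 3) * q)))) = ennreal (exp (- (3 * q)) * (1 / (1 - ?r)))"
    by (intro suminf_ennreal_eq) auto
  also have "\<dots> \<le> ennreal (exp (- (3 * q)) * (exp (2 * q) / (2 * q)))"
    using inverse_one_minus_exp_le(2)[of "2 * q"] assms
    by (intro ennreal_leI mult_left_mono) auto
  also have "exp (- (3 * q)) * (exp (2 * q) / (2 * q)) = exp (- q) / (2 * q)"
    by (simp add: exp_add[symmetric])
  finally show ?thesis .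
qed

text \<open>Term \<open>k\<close> covers the \<open>y\<close> between \<open>k \<epsilon> / 2\<close> and \<open>(k + 1) \<epsilon> / 2\<close>.  The step \<open>\<epsilon> / 2\<close> matters:
  slices of length \<open>\<epsilon>\<close> would only give weights that do not decay in \<open>k\<close>.\<close>

lemma exp_square_le_suminf:
  fixes m :: nat and y \<epsilon> \<sigma> :: real
  assumes y: "y \<ge> 0" and \<epsilon>: "\<epsilon> > 0" and \<sigma>: "\<sigma> > 0"
  shows "ennreal (exp (real m * y\<^sup>2 / (2 * \<sigma>\<^sup>2))) \<le>
    (\<Sum>k. ennreal (exp (- (real (2 * k + 3) * (\<epsilon>\<^sup>2 / (8 * \<sigma>\<^sup>2) * real m))) *
       exp (- ((real k / 2 + 1) * \<epsilon> / \<sigma>\<^sup>2) * (real m * (- (y + \<epsilon>)))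
            - (- ((real k / 2 + 1) * \<epsilon> / \<sigma>\<^sup>2))\<^sup>2 * \<sigma>\<^sup>2 * real m / 2)))"
    (is "_ \<le> (\<Sum>k. ?t k)")
proof -
  define k where "k = nat \<lfloor>2 * y / \<epsilon>\<rfloor>"
  have k: "real k \<le> 2 * y / \<epsilon>" "2 * y / \<epsilon> \<le> real k + 1"
    using y \<epsilon> unfolding k_def by (auto simp: of_nat_nat)
  \<comment> \<open>After scaling by \<open>\<epsilon>\<close>, every exponent carries the factor
    \<open>real m * \<epsilon>\<^sup>2 / (2 * \<sigma>\<^sup>2)\<close>, so a polynomial inequality
    in \<open>u\<close> and \<open>p\<close> remains.\<close>
  define u where "u = y / \<epsilon>"
  define p where "p = real k / 2"
  have u: "y = u * \<epsilon>" and p: "p \<ge> 0" "p \<le> u" "u - p \<le> 1 / 2"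
    using k \<epsilon> by (auto simp: u_def p_def field_simps)
  have "(u - p)\<^sup>2 \<le> (1 / 2)\<^sup>2" using p by (intro power_mono) auto
  \<comment> \<open>The right side exceeds \<open>u\<^sup>2\<close> by
    \<open>2 * u - p + 1 / 4 - (u - p)\<^sup>2\<close>, which is nonnegative because
    \<open>0 \<le> p \<le> u\<close> and \<open>u - p \<le> 1 / 2\<close>.\<close>
  then have key: "u\<^sup>2 \<le> - (4 * p + 3) / 4 + 2 * (p + 1) * (u + 1) - (p + 1)\<^sup>2"
    using p by (simp add: power2_eq_square field_simps)
  have "real m * y\<^sup>2 / (2 * \<sigma>\<^sup>2) = u\<^sup>2 * (real m * \<epsilon>\<^sup>2 / (2 * \<sigma>\<^sup>2))"
    by (simp add: u power_mult_distrib)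
  also have "\<dots> \<le> (- (4 * p + 3) / 4 + 2 * (p + 1) * (u + 1) - (p + 1)\<^sup>2) * (real m * \<epsilon>\<^sup>2 / (2 * \<sigma>\<^sup>2))"
    by (intro mult_right_mono key) auto
  also have "\<dots> = - (real (2 * k + 3) * (\<epsilon>\<^sup>2 / (8 * \<sigma>\<^sup>2) * real m)) +
      (- ((real k / 2 + 1) * \<epsilon> / \<sigma>\<^sup>2) * (real m * (- (y + \<epsilon>)))
            - (- ((real k / 2 + 1) * \<epsilon> / \<sigma>\<^sup>2))\<^sup>2 * \<sigma>\<^sup>2 * real m / 2)"
  proof -
    have kp: "real k = 2 * p" by (simp add: p_def)
    show ?thesis using \<sigma> by (simp add: kp u field_simps power2_eq_square)
  qed
  finally have "ennreal (exp (real m * y\<^sup>2 / (2 * \<sigma>\<^sup>2))) \<le> ?t k"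
    unfolding exp_add[symmetric] by (intro ennreal_leI) simp
  also have "\<dots> = (\<Sum>j\<in>{k}. ?t j)" by simp
  also have "\<dots> \<le> (\<Sum>k. ?t k)" by (intro sum_le_suminf) auto
  finally show ?thesis .
qed

text \<open>Collects all that is left beside the leading logarithmic term. For
  \<open>x \<le> 3\<close> the left side is at most 4 + 27 + 16 * 288 = 4639, hence the constant
  5000; for larger \<open>x\<close>, \<open>ln x \<ge> 1\<close> lets \<open>x * ln x\<close>
  dominate.\<close>

lemma log_terms_le:
  fixes x :: real
  assumes "x > 0"
  shows "4 + 9 * x + 16 * x * ln (1 + 32 * x) \<le> 5000 * max 1 (x * ln x)"
proof (cases "x \<le> 3")
  case True
  have "ln (1 + 32 * x) \<le> 96"
    using ln_add_one_self_le_self[of "32 * x"] assms True by simp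
  then have "x * ln (1 + 32 * x) \<le> 3 * 96"
    using assms True by (intro mult_mono) auto
  then show ?thesis using True by simp
next
  case False
  have "1 \<le> ln (3 :: real)" using exp_le by (simp add: ln_ge_iff)
  also have "\<dots> \<le> ln x" using False by simp
  finally have l: "1 \<le> ln x" .
  have "ln (1 + 32 * x) \<le> ln (33 * x)" using False by simp
  also have "\<dots> = ln 33 + ln x" using False by (simp add: ln_mult)
  also have "\<dots> \<le> 33 * ln x" using ln_le_minus_one[of "33 :: real"] l by simp
  finally have "x * ln (1 + 32 * x) \<le> x * (33 * ln x)" using assms by (intro mult_left_mono) auto
  moreover have "x * 1 \<le> x * ln x" using l assms by (intro mult_left_mono) auto
  ultimately have "4 + 9 * x + 16 * (x * ln (1 + 32 * x)) \<le> 5000 * (x * ln x)"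
    using False by (simp only: mult.left_commute mult_1_right)
  also have "\<dots> \<le> 5000 * max 1 (x * ln x)" by simp
  finally show ?thesis by (simp add: mult.assoc)
qed

section \<open>Recursions for pull counts and empirical means\<close>

lemma pull_count_Suc:
  "pull_count \<omega> (Suc n) a = pull_count \<omega> n a + (if pulled_arm \<omega> (Suc n) = a then 1 else 0)"
proof -
  have "{s \<in> {1..Suc n}. pulled_arm \<omega> s = a} =
      {s \<in> {1..n}. pulled_arm \<omega> s = a} \<union> (if pulled_arm \<omega> (Suc n) = a then {Suc n} else {})"
    by (auto simp: le_Suc_eq)
  then show ?thesis by (auto simp: pull_count_def)
qed

lemma pull_count_0 [simp]: "pull_count \<omega> 0 a = 0"
  by (simp add: pull_count_def)

lemma pull_count_le: "pull_count \<omega> n a \<le> n"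
  by (induction n) (auto simp: pull_count_Suc)

text \<open>For an arm not yet pulled the mean is \<open>0 / 0\<close>, but the count in front makes
  both sides vanish.\<close>

lemma pull_count_times_emp_mean:
  "real (pull_count \<omega> n a) * emp_mean \<omega> n a = (\<Sum>s\<in>{s \<in> {1..n}. pulled_arm \<omega> s = a}. reward \<omega> s)"
proof (cases "{s \<in> {1..n}. pulled_arm \<omega> s = a} = {}")
  case True
  then show ?thesis unfolding emp_mean_def pull_count_def by (simp only: True) simp
next
  case False
  then show ?thesis by (simp add: emp_mean_def pull_count_def card_gt_0_iff)
qed

text \<open>The centered reward sum is the exponent of the supermartingale below; here it is shown
  to grow only in rounds that pull \<open>a\<close>.\<close>

lemma centered_sum_Suc:
  "real (pull_count \<omega> (Suc n) a) * (emp_mean \<omega> (Suc n) a - \<mu>) =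
   real (pull_count \<omega> n a) * (emp_mean \<omega> n a - \<mu>) +
   (if pulled_arm \<omega> (Suc n) = a then reward \<omega> (Suc n) - \<mu> else 0)"
proof -
  have eq: "{s \<in> {1..Suc n}. pulled_arm \<omega> s = a} =
      (if pulled_arm \<omega> (Suc n) = a then insert (Suc n) {s \<in> {1..n}. pulled_arm \<omega> s = a}
       else {s \<in> {1..n}. pulled_arm \<omega> s = a})"
    by (auto simp: le_Suc_eq)
  show ?thesis
    unfolding right_diff_distrib pull_count_times_emp_mean eq
    by (simp add: pull_count_Suc algebra_simps)
qed

section \<open>Adapted functions and conditioning on the history\<close>

locale maillard_bandit =
  fixes K :: nat and \<sigma> :: real and \<nu> :: "nat \<Rightarrow> real measure"
  assumes K_ge1: "K \<ge> 1" and sigma_pos: "\<sigma> > 0"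
    and sub_gaussian_arms: "\<And>a. a \<in> {1..K} \<Longrightarrow> sub_gaussian \<sigma> (\<nu> a)"
begin

abbreviation \<pi> :: policy where "\<pi> \<equiv> maillard_sampling K \<sigma>"

abbreviation law :: "trajectory measure" where "law \<equiv> bandit_law K \<nu> \<pi>"

abbreviation hist :: "nat \<Rightarrow> trajectory measure" where
  "hist n \<equiv> PiM {0..<n} (\<lambda>_. round_space K)"

sublocale IT: Ionescu_Tulcea "round_kernel K \<nu> \<pi>" "\<lambda>_. round_space K"
  using K_ge1 sub_gaussian_arms
  by (intro Ionescu_Tulcea_maillard_sampling) (auto simp: sub_gaussian_def)

sublocale law: prob_space law
  using prob_space_bandit_law(1)[OF K_ge1 sub_gaussian_arms] .

lemma sets_law [measurable_cong]: "sets law = sets (PiM UNIV (\<lambda>_. round_space K))"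
  using prob_space_bandit_law(2)[OF K_ge1 sub_gaussian_arms] .

lemma space_law: "space law = space (PiM UNIV (\<lambda>_. round_space K))"
  by (rule sets_eq_imp_space_eq[OF sets_law])

lemma space_round_space: "space (round_space K) = {1..K} \<times> UNIV"
  by (simp add: round_space_def space_pair_measure)

lemma pulled_arm_space: "\<omega> \<in> space law \<Longrightarrow> pulled_arm \<omega> t \<in> {1..K}"
proof -
  assume "\<omega> \<in> space law"
  then have "\<omega> (t - 1) \<in> space (round_space K)" by (simp add: space_law space_PiM PiE_iff)
  then show ?thesis by (cases "\<omega> (t - 1)") (simp add: space_round_space pulled_arm_def)
qed

lemma nn_integral_round_kernel:
  assumes g: "g \<in> borel_measurable (round_space K)"
  shows "(\<integral>\<^sup>+x. g x \<partial>round_kernel K \<nu> \<pi> n \<omega>) =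
    (\<Sum>a\<in>{1..K}. ennreal (\<pi> (Suc n) \<omega> a) * (\<integral>\<^sup>+y. g (a, y) \<partial>\<nu> a))"
proof -
  let ?d = "\<lambda>a. distr (\<nu> a) (round_space K) (\<lambda>y. (a, y))"
  have mp: "(\<lambda>y. (a, y)) \<in> measurable (\<nu> a) (round_space K)" if "a \<in> {1..K}" for a
  proof -
    have "(\<lambda>y. (a, y)) \<in> measurable borel (round_space K)"
      using that unfolding round_space_def by (intro measurable_Pair1') simp
    then show ?thesis
      using sub_gaussian_arms[OF that] by (simp add: sub_gaussian_def cong: measurable_cong_sets)
  qed
  have d: "?d \<in> measurable (point_measure {1..K} (\<lambda>a. ennreal (\<pi> (Suc n) \<omega> a)))
      (subprob_algebra (round_space K))"
    using mp sub_gaussian_arms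
    by (auto simp: space_subprob_algebra sub_gaussian_def
        intro!: prob_space_imp_subprob_space prob_space.prob_space_distr)
  have "(\<integral>\<^sup>+x. g x \<partial>round_kernel K \<nu> \<pi> n \<omega>) =
      (\<Sum>a\<in>{1..K}. ennreal (\<pi> (Suc n) \<omega> a) * (\<integral>\<^sup>+x. g x \<partial>?d a))"
    unfolding round_kernel_def
    by (subst nn_integral_bind[OF g d]) (simp add: nn_integral_point_measure_finite mult.commute)
  also have "\<dots> = (\<Sum>a\<in>{1..K}. ennreal (\<pi> (Suc n) \<omega> a) * (\<integral>\<^sup>+y. g (a, y) \<partial>\<nu> a))"
    using g by (intro sum.cong refl arg_cong2[where f="(*)"] nn_integral_distr mp) auto
  finally show ?thesis .
qed

text \<open>The marginal of the projective limit on the first \<open>n\<close> coordinates is the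
  composition of the first \<open>n\<close> kernels. This reduces integrals over infinite
  trajectories to finite histories.\<close>

lemma nn_integral_law_restrict:
  assumes f: "f \<in> borel_measurable (hist n)"
  shows "(\<integral>\<^sup>+\<omega>. f (restrict \<omega> {0..<n}) \<partial>law) = (\<integral>\<^sup>+\<omega>. f \<omega> \<partial>IT.C 0 n (\<lambda>_. undefined))"
proof -
  \<comment> \<open>\<open>IT.up_to\<close> is the least bound beyond which the index set has no
    element, so it is \<open>n\<close> for an initial segment.\<close>
  have "IT.up_to {0..<n} \<le> n" "{0..<n} \<subseteq> {0..<IT.up_to {0..<n}}"
    by (simp_all add: IT.up_to_iff_Ico IT.up_to del: ivl_subset)
  then have up: "IT.up_to {0..<n} = n" by (cases "n = 0") auto
  have "(\<integral>\<^sup>+\<omega>. f (restrict \<omega> {0..<n}) \<partial>law) =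
      (\<integral>\<^sup>+\<omega>. f \<omega> \<partial>distr law (hist n) (\<lambda>\<omega>. restrict \<omega> {0..<n}))"
    using f by (subst nn_integral_distr) (simp_all add: measurable_restrict_subset cong: measurable_cong_sets)
  also have "\<dots> = (\<integral>\<^sup>+\<omega>. f \<omega> \<partial>IT.CI {0..<n})"
    unfolding bandit_law_def by (subst IT.distr_lim) auto
  also have "\<dots> = (\<integral>\<^sup>+\<omega>. f (restrict \<omega> {0..<n}) \<partial>IT.C 0 n (\<lambda>_. undefined))"
    unfolding IT.CI_def up using f
    by (subst nn_integral_distr)
      (auto simp: measurable_cong_sets[OF IT.sets_C] intro!: measurable_restrict_subset)
  \<comment> \<open>Trajectories in this space are already \<open>undefined\<close> from coordinate
    \<open>n\<close> on, so restricting changes nothing.\<close>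
  also have "\<dots> = (\<integral>\<^sup>+\<omega>. f \<omega> \<partial>IT.C 0 n (\<lambda>_. undefined))"
    by (intro nn_integral_cong) (auto simp: IT.space_C space_PiM)
  finally show ?thesis .
qed

text \<open>Measurable with respect to the first \<open>n\<close> rounds.  The second conjunct is not implied by the
  first, which only concerns trajectories that are \<open>undefined\<close> from coordinate \<open>n\<close> on.\<close>

definition adapted :: "nat \<Rightarrow> (trajectory \<Rightarrow> 'b::topological_space) \<Rightarrow> bool" where
  "adapted n f \<longleftrightarrow> f \<in> borel_measurable (hist n) \<and>
     (\<forall>\<omega> \<omega>'. (\<forall>i<n. \<omega> i = \<omega>' i) \<longrightarrow> f \<omega> = f \<omega>')"

lemma adapted_cong: "adapted n f \<Longrightarrow> (\<And>i. i < n \<Longrightarrow> \<omega> i = \<omega>' i) \<Longrightarrow> f \<omega> = f \<omega>'"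
  unfolding adapted_def by blast

lemma adapted_restrict: "adapted n f \<Longrightarrow> {0..<n} \<subseteq> J \<Longrightarrow> f (restrict \<omega> J) = f \<omega>"
  by (rule adapted_cong) (auto simp: subset_eq)

lemma adapted_fun_upd: "adapted n f \<Longrightarrow> f (fun_upd \<omega> n x) = f \<omega>"
  by (rule adapted_cong) auto

text \<open>The function factors through the restriction to the first \<open>n\<close> coordinates;
  the second conjunct of \<open>adapted\<close> identifies it with that composition.\<close>

lemma adapted_measurable:
  assumes "adapted n f" "{0..<n} \<subseteq> J"
  shows "f \<in> borel_measurable (PiM J (\<lambda>_. round_space K))"
proof -
  have "(\<lambda>\<omega>. f (restrict \<omega> {0..<n})) \<in> borel_measurable (PiM J (\<lambda>_. round_space K))"
    using assms unfolding adapted_def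
    by (intro measurable_compose[OF measurable_restrict_subset]) auto
  then show ?thesis by (simp add: adapted_restrict[OF assms(1)])
qed

lemma adapted_law: "adapted n f \<Longrightarrow> f \<in> borel_measurable law"
  using adapted_measurable[of n f UNIV] by (simp add: measurable_cong_sets[OF sets_law refl])

lemma adapted_mono:
  assumes "adapted n f" "n \<le> m"
  shows "adapted m f"
  unfolding adapted_def
proof (intro conjI allI impI)
  show "f \<in> borel_measurable (hist m)" using adapted_measurable[OF assms(1)] assms(2) by simp
  show "f \<omega> = f \<omega>'" if "\<forall>i<m. \<omega> i = \<omega>' i" for \<omega> \<omega>'
    using that assms(2) by (intro adapted_cong[OF assms(1)]) simp
qed

lemma history_cong:
  assumes "\<forall>i<n. \<omega> i = \<omega>' i"
  shows "pull_count \<omega> n a = pull_count \<omega>' n a" "emp_mean \<omega> n a = emp_mean \<omega>' n a"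
proof -
  have arm: "pulled_arm \<omega> s = pulled_arm \<omega>' s" and rew: "reward \<omega> s = reward \<omega>' s"
    if "s \<in> {1..n}" for s
    using that assms by (auto simp: pulled_arm_def reward_def)
  have eq: "{s \<in> {1..n}. pulled_arm \<omega> s = a} = {s \<in> {1..n}. pulled_arm \<omega>' s = a}"
    using arm by auto
  show N: "pull_count \<omega> n a = pull_count \<omega>' n a"
    unfolding pull_count_def eq ..
  show "emp_mean \<omega> n a = emp_mean \<omega>' n a"
    unfolding emp_mean_def N eq using rew by (intro arg_cong2[where f="(/)"] sum.cong refl) auto
qed

lemma adapted_pull_count: "adapted n (\<lambda>\<omega>. real (pull_count \<omega> n a))"
  unfolding adapted_def by (intro conjI allI impI measurable_pull_count) (simp add: history_cong(1))

lemma adapted_emp_mean: "adapted n (\<lambda>\<omega>. emp_mean \<omega> n a)"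
  unfolding adapted_def by (intro conjI allI impI measurable_emp_mean) (rule history_cong(2))

lemma emp_gap_cong: "\<forall>i<n. \<omega> i = \<omega>' i \<Longrightarrow> emp_gap K \<omega> n a = emp_gap K \<omega>' n a"
  by (simp add: emp_gap_def history_cong(2)[of n \<omega> \<omega>'])

lemma adapted_emp_gap: "adapted n (\<lambda>\<omega>. emp_gap K \<omega> n a)"
  unfolding adapted_def
proof (intro conjI allI impI)
  show "(\<lambda>\<omega>. emp_gap K \<omega> n a) \<in> borel_measurable (hist n)"
    unfolding emp_gap_def by (intro borel_measurable_diff borel_measurable_Max measurable_emp_mean) auto
qed (rule emp_gap_cong)

lemma adapted_maillard_sampling: "adapted n (\<lambda>\<omega>. \<pi> (Suc n) \<omega> a)"
  unfolding adapted_def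
proof (intro conjI allI impI)
  fix \<omega> \<omega>' :: trajectory assume eq: "\<forall>i<n. \<omega> i = \<omega>' i"
  show "\<pi> (Suc n) \<omega> a = \<pi> (Suc n) \<omega>' a"
    by (simp add: maillard_sampling_def ms_weight_def history_cong(1)[OF eq] emp_gap_cong[OF eq])
qed (rule measurable_maillard_sampling[OF K_ge1])

text \<open>Given the history, coordinate \<open>n\<close> is distributed according to the round
  kernel. Testing against an adapted factor \<open>G\<close> expresses this without conditional
  expectations: pass to the finite history, peel off the last kernel, and return to
  \<open>law\<close>.\<close>

lemma nn_integral_one_step:
  assumes G: "adapted n (G :: trajectory \<Rightarrow> ennreal)" and g: "g \<in> borel_measurable (round_space K)"
  shows "(\<integral>\<^sup>+\<omega>. G \<omega> * g (\<omega> n) \<partial>law) =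
    (\<integral>\<^sup>+\<omega>. G \<omega> * (\<Sum>a\<in>{1..K}. ennreal (\<pi> (Suc n) \<omega> a) * (\<integral>\<^sup>+y. g (a, y) \<partial>\<nu> a)) \<partial>law)"
proof -
  let ?C = "\<lambda>n. IT.C 0 n (\<lambda>_. undefined)"
  let ?h = "\<lambda>\<omega>. (\<Sum>a\<in>{1..K}. ennreal (\<pi> (Suc n) \<omega> a) * (\<integral>\<^sup>+y. g (a, y) \<partial>\<nu> a))"
  have Gn: "G \<in> borel_measurable (hist n)" and GS: "G \<in> borel_measurable (hist (Suc n))"
    using adapted_measurable[OF G] by auto
  have \<pi>: "\<pi> (Suc n) (restrict \<omega> {0..<n}) a = \<pi> (Suc n) \<omega> a" for \<omega> a
    by (rule adapted_restrict[OF adapted_maillard_sampling]) simp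
  have f: "(\<lambda>\<omega>. G \<omega> * g (\<omega> n)) \<in> borel_measurable (hist (Suc n))"
    by (intro borel_measurable_times_ennreal GS measurable_compose[OF _ g]
        measurable_component_singleton) auto
  have "(\<integral>\<^sup>+\<omega>. G \<omega> * g (\<omega> n) \<partial>law) =
      (\<integral>\<^sup>+\<omega>. (\<lambda>\<omega>. G \<omega> * g (\<omega> n)) (restrict \<omega> {0..<Suc n}) \<partial>law)"
    by (simp add: adapted_restrict[OF G] del: restrict_apply) (simp add: restrict_def)
  also have "\<dots> = (\<integral>\<^sup>+\<omega>. G \<omega> * g (\<omega> n) \<partial>?C (Suc n))"
    by (rule nn_integral_law_restrict[OF f])
  \<comment> \<open>The composition of \<open>Suc n\<close> kernels is that of \<open>n\<close>
    kernels followed by \<open>IT.eP n\<close>, which appends coordinate \<open>n\<close>.\<close>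
  also have "\<dots> = (\<integral>\<^sup>+\<omega>. (\<integral>\<^sup>+\<omega>'. G \<omega>' * g (\<omega>' n) \<partial>IT.eP n \<omega>) \<partial>?C n)"
    using f IT.measurable_eP[of n]
    by (simp add: nn_integral_bind[where B="hist (Suc n)"] measurable_cong_sets[OF IT.sets_C])
  also have "\<dots> = (\<integral>\<^sup>+\<omega>. G \<omega> * ?h \<omega> \<partial>?C n)"
  proof (intro nn_integral_cong)
    fix \<omega> assume "\<omega> \<in> space (?C n)"
    then have \<omega>: "\<omega> \<in> space (hist n)" by (simp add: IT.space_C)
    have "(\<integral>\<^sup>+\<omega>'. G \<omega>' * g (\<omega>' n) \<partial>IT.eP n \<omega>) =
        (\<integral>\<^sup>+x. G \<omega> * g x \<partial>round_kernel K \<nu> \<pi> n \<omega>)"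
      by (subst IT.nn_integral_eP[OF \<omega> f]) (simp add: adapted_fun_upd[OF G])
    also have "\<dots> = G \<omega> * ?h \<omega>"
      using g by (subst nn_integral_cmult)
        (simp_all add: nn_integral_round_kernel measurable_cong_sets[OF IT.sets_P[OF \<omega>] refl])
    finally show "(\<integral>\<^sup>+\<omega>'. G \<omega>' * g (\<omega>' n) \<partial>IT.eP n \<omega>) = G \<omega> * ?h \<omega>" .
  qed
  also have "\<dots> = (\<integral>\<^sup>+\<omega>. (\<lambda>\<omega>. G \<omega> * ?h \<omega>) (restrict \<omega> {0..<n}) \<partial>law)"
    by (intro nn_integral_law_restrict[symmetric] borel_measurable_times_ennreal Gn borel_measurable_sum
        measurable_compose[OF measurable_maillard_sampling[OF K_ge1] measurable_ennreal] borel_measurable_const)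
  also have "\<dots> = (\<integral>\<^sup>+\<omega>. G \<omega> * ?h \<omega> \<partial>law)"
    by (simp add: adapted_restrict[OF G] \<pi> del: restrict_apply)
  finally show ?thesis .
qed


section \<open>Closure properties of adapted functions\<close>

lemma adapted_const: "adapted n (\<lambda>_. c)"
  by (simp add: adapted_def)

lemma adapted_compose:
  assumes "adapted n f" "h \<in> borel_measurable borel"
  shows "adapted n (\<lambda>\<omega>. h (f \<omega>))"
  unfolding adapted_def
proof (intro conjI allI impI)
  show "(\<lambda>\<omega>. h (f \<omega>)) \<in> borel_measurable (hist n)"
    by (rule measurable_compose[OF _ assms(2)]) (use assms(1) in \<open>simp add: adapted_def\<close>)
  show "h (f \<omega>) = h (f \<omega>')" if "\<forall>i<n. \<omega> i = \<omega>' i" for \<omega> \<omega>'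
    using that by (intro arg_cong[where f=h] adapted_cong[OF assms(1)]) simp
qed

lemma adapted_add:
  fixes f g :: "trajectory \<Rightarrow> ennreal"
  assumes "adapted n f" "adapted n g"
  shows "adapted n (\<lambda>\<omega>. f \<omega> + g \<omega>)"
  unfolding adapted_def
proof (intro conjI allI impI)
  show "(\<lambda>\<omega>. f \<omega> + g \<omega>) \<in> borel_measurable (hist n)"
    using assms by (intro borel_measurable_add) (auto simp: adapted_def)
  show "f \<omega> + g \<omega> = f \<omega>' + g \<omega>'" if "\<forall>i<n. \<omega> i = \<omega>' i" for \<omega> \<omega>'
    using that by (intro arg_cong2[where f="(+)"] adapted_cong[OF assms(1)] adapted_cong[OF assms(2)]) auto
qed

lemma adapted_mult:
  fixes f g :: "trajectory \<Rightarrow> ennreal"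
  assumes "adapted n f" "adapted n g"
  shows "adapted n (\<lambda>\<omega>. f \<omega> * g \<omega>)"
  unfolding adapted_def
proof (intro conjI allI impI)
  show "(\<lambda>\<omega>. f \<omega> * g \<omega>) \<in> borel_measurable (hist n)"
    using assms by (intro borel_measurable_times_ennreal) (auto simp: adapted_def)
  show "f \<omega> * g \<omega> = f \<omega>' * g \<omega>'" if "\<forall>i<n. \<omega> i = \<omega>' i" for \<omega> \<omega>'
    using that by (intro arg_cong2[where f="(*)"] adapted_cong[OF assms(1)] adapted_cong[OF assms(2)]) auto
qed

lemma adapted_round:
  fixes g :: "nat \<times> real \<Rightarrow> ennreal"
  assumes "g \<in> borel_measurable (round_space K)"
  shows "adapted (Suc n) (\<lambda>\<omega>. g (\<omega> n))"
  unfolding adapted_def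
proof (intro conjI allI impI)
  show "(\<lambda>\<omega>. g (\<omega> n)) \<in> borel_measurable (hist (Suc n))"
    by (intro measurable_compose[OF _ assms] measurable_component_singleton) simp
qed simp

lemma measurable_round_arm:
  assumes "h \<in> borel_measurable borel"
  shows "(\<lambda>x. if fst x = a then h (snd x) else 1 :: ennreal) \<in> borel_measurable (round_space K)"
proof -
  have 0: "(\<lambda>x. snd x) \<in> measurable (round_space K) borel"
    and 1: "(\<lambda>x. fst x) \<in> measurable (round_space K) (count_space {1..K})"
    by (simp_all add: round_space_def)
  have 2: "(\<lambda>x. h (snd x)) \<in> borel_measurable (round_space K)"
    by (rule measurable_compose[OF 0 assms])
  have "Measurable.pred (round_space K) (\<lambda>x. fst x = a)"
    using measurable_compose[OF 1, of "\<lambda>x. x = a" "count_space UNIV"] by simp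
  with 2 show ?thesis by (intro measurable_If) (auto simp: pred_def)
qed

section \<open>Conditional probability of a pull\<close>

lemma prob_space_arm: "a \<in> {1..K} \<Longrightarrow> prob_space (\<nu> a)"
  using sub_gaussian_arms by (simp add: sub_gaussian_def)

lemma sum_policy: "(\<Sum>a\<in>{1..K}. ennreal (\<pi> (Suc n) \<omega> a)) = 1"
  using maillard_sampling_sum[OF K_ge1, of "Suc n" \<sigma> \<omega>]
  by (simp add: sum_ennreal maillard_sampling_nonneg)

text \<open>Values in \<open>ennreal\<close> keep the whole count within nonnegative integrals,
  where sums and limits exchange without integrability conditions.\<close>

definition pulls :: "nat \<Rightarrow> nat \<Rightarrow> trajectory \<Rightarrow> ennreal" where
  "pulls a n \<omega> = (if pulled_arm \<omega> (Suc n) = a then 1 else 0)"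

lemma adapted_pulls: "adapted (Suc n) (pulls a n)"
proof -
  have 1: "(\<lambda>x. fst x) \<in> measurable (round_space K) (count_space {1..K})"
    by (simp add: round_space_def)
  have "(\<lambda>x. if fst x = a then 1 else 0 :: ennreal) \<in> borel_measurable (round_space K)"
    using measurable_compose[OF 1, of "\<lambda>i. if i = a then 1 else 0 :: ennreal" borel] by simp
  from adapted_round[OF this, of n] show ?thesis
    by (simp add: pulls_def[abs_def] pulled_arm_def)
qed

text \<open>The tower property for the indicator of a pull. It is used in both directions: to
  replace a pull of one arm by its probability, and to turn the probability of another arm back into
  a pull.\<close>

lemma nn_integral_pulls:
  assumes a: "a \<in> {1..K}" and G: "adapted n G"
  shows "(\<integral>\<^sup>+\<omega>. G \<omega> * pulls a n \<omega> \<partial>law) = (\<integral>\<^sup>+\<omega>. G \<omega> * ennreal (\<pi> (Suc n) \<omega> a) \<partial>law)"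
proof -
  let ?g = "\<lambda>x :: nat \<times> real. if fst x = a then 1 else 0 :: ennreal"
  have 1: "(\<lambda>x. fst x) \<in> measurable (round_space K) (count_space {1..K})"
    by (simp add: round_space_def)
  have g: "?g \<in> borel_measurable (round_space K)"
    using measurable_compose[OF 1, of "\<lambda>i. if i = a then 1 else 0 :: ennreal" borel] by simp
  have "(\<Sum>b\<in>{1..K}. ennreal (\<pi> (Suc n) \<omega> b) * (\<integral>\<^sup>+y. ?g (b, y) \<partial>\<nu> b)) = ennreal (\<pi> (Suc n) \<omega> a)" for \<omega>
  proof -
    have "(\<Sum>b\<in>{1..K}. ennreal (\<pi> (Suc n) \<omega> b) * (\<integral>\<^sup>+y. ?g (b, y) \<partial>\<nu> b)) =
        (\<Sum>b\<in>{1..K}. if b = a then ennreal (\<pi> (Suc n) \<omega> b) else 0)"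
      using prob_space_arm by (intro sum.cong refl) (auto simp: prob_space.emeasure_space_1)
    then show ?thesis using a by (simp add: sum.delta)
  qed
  then show ?thesis
    using nn_integral_one_step[OF G g] by (simp add: pulls_def pulled_arm_def)
qed

section \<open>Stopped exponential supermartingales\<close>

text \<open>A product of normalized moment generating factors, one for each of the first
  \<open>m\<close> pulls of \<open>a\<close>. After the \<open>m\<close>-th pull it is frozen, so
  its value there can be read off at any later horizon.\<close>

primrec stopped_exp :: "nat \<Rightarrow> nat \<Rightarrow> real \<Rightarrow> nat \<Rightarrow> trajectory \<Rightarrow> ennreal" where
  "stopped_exp a m l 0 \<omega> = 1"
| "stopped_exp a m l (Suc n) \<omega> = stopped_exp a m l n \<omega> *
     (if pulled_arm \<omega> (Suc n) = a \<and> pull_count \<omega> n a < m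
      then ennreal (exp (l * (reward \<omega> (Suc n) - arm_mean \<nu> a) - l\<^sup>2 * \<sigma>\<^sup>2 / 2)) else 1)"

context
  fixes a m :: nat and l :: real
  assumes a: "a \<in> {1..K}"
begin

definition exp_increment :: "nat \<times> real \<Rightarrow> ennreal" where
  "exp_increment x =
     (if fst x = a then ennreal (exp (l * (snd x - arm_mean \<nu> a) - l\<^sup>2 * \<sigma>\<^sup>2 / 2)) else 1)"

lemma measurable_exp_increment: "exp_increment \<in> borel_measurable (round_space K)"
  unfolding exp_increment_def[abs_def] by (rule measurable_round_arm) measurable

lemma stopped_exp_Suc:
  "stopped_exp a m l (Suc n) \<omega> =
     (stopped_exp a m l n \<omega> * (if real (pull_count \<omega> n a) < m then 1 else 0)) * exp_increment (\<omega> n) +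
     stopped_exp a m l n \<omega> * (if real (pull_count \<omega> n a) < m then 0 else 1)"
  by (auto simp: exp_increment_def pulled_arm_def reward_def)

lemma adapted_stopped_exp: "adapted n (stopped_exp a m l n)"
proof (induction n)
  case 0
  show ?case by (simp add: adapted_const)
next
  case (Suc n)
  have I: "adapted n (\<lambda>\<omega>. if real (pull_count \<omega> n a) < m then x else y :: ennreal)" for x y
    by (rule adapted_compose[OF adapted_pull_count]) measurable
  show ?case
    unfolding stopped_exp_Suc[abs_def]
    by (intro adapted_add adapted_mult adapted_round measurable_exp_increment
        adapted_mono[OF Suc] adapted_mono[OF I]) auto
qed

text \<open>The sub-Gaussian bound divided by its right-hand side.\<close>

lemma nn_integral_exp_arm:
  "(\<integral>\<^sup>+y. ennreal (exp (l * (y - arm_mean \<nu> a) - l\<^sup>2 * \<sigma>\<^sup>2 / 2)) \<partial>\<nu> a) \<le> 1"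
proof -
  have i: "integrable (\<nu> a) (\<lambda>y. exp (l * (y - arm_mean \<nu> a)))"
    and le: "(\<integral>y. exp (l * (y - arm_mean \<nu> a)) \<partial>\<nu> a) \<le> exp (l\<^sup>2 * \<sigma>\<^sup>2 / 2)"
    using sub_gaussian_arms[OF a] by (auto simp: sub_gaussian_def arm_mean_def)
  have "(\<integral>\<^sup>+y. ennreal (exp (l * (y - arm_mean \<nu> a) - l\<^sup>2 * \<sigma>\<^sup>2 / 2)) \<partial>\<nu> a) =
      (\<integral>\<^sup>+y. ennreal (exp (l * (y - arm_mean \<nu> a)) / exp (l\<^sup>2 * \<sigma>\<^sup>2 / 2)) \<partial>\<nu> a)"
    by (simp add: exp_diff)
  also have "\<dots> = ennreal (\<integral>y. exp (l * (y - arm_mean \<nu> a)) / exp (l\<^sup>2 * \<sigma>\<^sup>2 / 2) \<partial>\<nu> a)"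
    using i by (intro nn_integral_eq_integral) auto
  also have "\<dots> \<le> 1"
    using le by simp
  finally show ?thesis .
qed

lemma nn_integral_stopped_exp: "(\<integral>\<^sup>+\<omega>. stopped_exp a m l n \<omega> \<partial>law) \<le> 1"
proof (induction n)
  case 0
  show ?case by (simp add: law.emeasure_space_1)
next
  case (Suc n)
  let ?V = "stopped_exp a m l n"
  let ?G = "\<lambda>\<omega>. ?V \<omega> * (if real (pull_count \<omega> n a) < m then 1 else 0)"
  let ?H = "\<lambda>\<omega>. ?V \<omega> * (if real (pull_count \<omega> n a) < m then 0 else 1)"
  have I: "adapted n (\<lambda>\<omega>. if real (pull_count \<omega> n a) < m then x else y :: ennreal)" for x y
    by (rule adapted_compose[OF adapted_pull_count]) measurable
  have G: "adapted n ?G" and H: "adapted n ?H"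
    by (intro adapted_mult adapted_stopped_exp I)+
  \<comment> \<open>Arm \<open>a\<close> contributes a mean of at most 1 and every other arm exactly
    1, so the bound holds for any sampling probabilities. This is why adaptive sampling does no
    harm.\<close>
  have "(\<Sum>b\<in>{1..K}. ennreal (\<pi> (Suc n) \<omega> b) * (\<integral>\<^sup>+y. exp_increment (b, y) \<partial>\<nu> b)) \<le>
      (\<Sum>b\<in>{1..K}. ennreal (\<pi> (Suc n) \<omega> b) * 1)" for \<omega>
  proof (intro sum_mono mult_left_mono)
    fix b assume "b \<in> {1..K}"
    then show "(\<integral>\<^sup>+y. exp_increment (b, y) \<partial>\<nu> b) \<le> 1"
      using nn_integral_exp_arm prob_space_arm[of b]
      by (cases "b = a") (simp_all add: exp_increment_def prob_space.emeasure_space_1)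
  qed simp
  then have le: "(\<Sum>b\<in>{1..K}. ennreal (\<pi> (Suc n) \<omega> b) * (\<integral>\<^sup>+y. exp_increment (b, y) \<partial>\<nu> b)) \<le> 1" for \<omega>
    by (simp only: mult_1_right sum_policy)
  have "(\<integral>\<^sup>+\<omega>. stopped_exp a m l (Suc n) \<omega> \<partial>law) =
      (\<integral>\<^sup>+\<omega>. ?G \<omega> * exp_increment (\<omega> n) \<partial>law) + (\<integral>\<^sup>+\<omega>. ?H \<omega> \<partial>law)"
    unfolding stopped_exp_Suc
    by (intro nn_integral_add adapted_law[OF H]
        adapted_law[OF adapted_mult[OF adapted_mono[OF G] adapted_round[OF measurable_exp_increment]]]) simp
  also have "\<dots> \<le> (\<integral>\<^sup>+\<omega>. ?G \<omega> * 1 \<partial>law) + (\<integral>\<^sup>+\<omega>. ?H \<omega> \<partial>law)"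
    unfolding nn_integral_one_step[OF G measurable_exp_increment]
    by (intro add_right_mono nn_integral_mono mult_left_mono le) simp
  also have "\<dots> = (\<integral>\<^sup>+\<omega>. ?G \<omega> * 1 + ?H \<omega> \<partial>law)"
    using adapted_law[OF G] adapted_law[OF H] by (intro nn_integral_add[symmetric]) auto
  also have "\<dots> = (\<integral>\<^sup>+\<omega>. ?V \<omega> \<partial>law)"
    by (intro nn_integral_cong) simp
  also note Suc
  finally show ?case .
qed

text \<open>Up to the \<open>m\<close>-th pull nothing is frozen, so the exponents of all factors
  simply add up.\<close>

lemma stopped_exp_eq:
  "pull_count \<omega> n a \<le> m \<Longrightarrow> stopped_exp a m l n \<omega> =
     ennreal (exp (l * (real (pull_count \<omega> n a) * (emp_mean \<omega> n a - arm_mean \<nu> a))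
                   - l\<^sup>2 * \<sigma>\<^sup>2 * real (pull_count \<omega> n a) / 2))"
proof (induction n)
  case (Suc n)
  then have V: "stopped_exp a m l n \<omega> =
     ennreal (exp (l * (real (pull_count \<omega> n a) * (emp_mean \<omega> n a - arm_mean \<nu> a))
                   - l\<^sup>2 * \<sigma>\<^sup>2 * real (pull_count \<omega> n a) / 2))"
    by (auto simp: pull_count_Suc split: if_splits)
  show ?case
  proof (cases "pulled_arm \<omega> (Suc n) = a")
    case True
    with Suc.prems have "pull_count \<omega> n a < m" by (simp add: pull_count_Suc)
    with True have "stopped_exp a m l (Suc n) \<omega> = stopped_exp a m l n \<omega> *
        ennreal (exp (l * (reward \<omega> (Suc n) - arm_mean \<nu> a) - l\<^sup>2 * \<sigma>\<^sup>2 / 2))"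
      by simp
    also have "\<dots> = ennreal (exp ((l * (real (pull_count \<omega> n a) * (emp_mean \<omega> n a - arm_mean \<nu> a))
          - l\<^sup>2 * \<sigma>\<^sup>2 * real (pull_count \<omega> n a) / 2)
          + (l * (reward \<omega> (Suc n) - arm_mean \<nu> a) - l\<^sup>2 * \<sigma>\<^sup>2 / 2)))"
      unfolding V exp_add by (simp only: ennreal_mult'' exp_ge_zero)
    also have "\<dots> = ennreal (exp (l * (real (pull_count \<omega> (Suc n) a) * (emp_mean \<omega> (Suc n) a - arm_mean \<nu> a))
          - l\<^sup>2 * \<sigma>\<^sup>2 * real (pull_count \<omega> (Suc n) a) / 2))"
      unfolding centered_sum_Suc using True
      by (intro arg_cong[where f=ennreal] arg_cong[where f=exp])
        (simp add: pull_count_Suc distrib_left add_divide_distrib)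
    finally show ?thesis .
  next
    case False
    then show ?thesis unfolding centered_sum_Suc by (simp add: V pull_count_Suc)
  qed
qed simp

text \<open>Evaluated just before the \<open>m + 1\<close>-st pull of \<open>a\<close>, when the
  empirical mean averages exactly the first \<open>m\<close> rewards of that arm.\<close>

definition exp_at :: "nat \<Rightarrow> trajectory \<Rightarrow> ennreal" where
  "exp_at n \<omega> = (if pulled_arm \<omega> (Suc n) = a \<and> pull_count \<omega> n a = m
     then ennreal (exp (l * (real m * (emp_mean \<omega> n a - arm_mean \<nu> a)) - l\<^sup>2 * \<sigma>\<^sup>2 * real m / 2)) else 0)"

text \<open>At most one round is the \<open>(m + 1)\<close>-st pull of \<open>a\<close>, and the stopped process already has its
  final value there.\<close>

lemma sum_exp_at:
  "(\<Sum>n<T. exp_at n \<omega>) = (if pull_count \<omega> T a > m then stopped_exp a m l T \<omega> else 0)"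
proof (induction T)
  case (Suc T)
  show ?case
  proof (cases "pull_count \<omega> T a" m rule: linorder_cases)
    case equal
    then show ?thesis
      using Suc stopped_exp_eq[of \<omega> T] by (auto simp: exp_at_def pull_count_Suc)
  qed (use Suc in \<open>auto simp: exp_at_def pull_count_Suc\<close>)
qed simp

lemma nn_integral_sum_exp_at: "(\<integral>\<^sup>+\<omega>. (\<Sum>n<T. exp_at n \<omega>) \<partial>law) \<le> 1"
proof -
  have "(\<integral>\<^sup>+\<omega>. (\<Sum>n<T. exp_at n \<omega>) \<partial>law) \<le> (\<integral>\<^sup>+\<omega>. stopped_exp a m l T \<omega> \<partial>law)"
    unfolding sum_exp_at by (intro nn_integral_mono) auto
  also note nn_integral_stopped_exp
  finally show ?thesis .
qed

end

section \<open>Deviations at a fixed pull count\<close>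

lemma adapted_pulls_at:
  fixes F :: "real \<Rightarrow> ennreal"
  assumes F: "F \<in> borel_measurable borel"
  shows "adapted (Suc n) (\<lambda>\<omega>. if pulled_arm \<omega> (Suc n) = a \<and> pull_count \<omega> n a = m
           then F (emp_mean \<omega> n a) else 0)"
proof -
  have "adapted n (\<lambda>\<omega>. if real (pull_count \<omega> n a) = real m then 1 else 0 :: ennreal)"
    by (rule adapted_compose[OF adapted_pull_count]) measurable
  then have "adapted (Suc n) (\<lambda>\<omega>. pulls a n \<omega> *
      ((if real (pull_count \<omega> n a) = real m then 1 else 0) * F (emp_mean \<omega> n a)))"
    by (intro adapted_mult adapted_pulls adapted_mono[of n _ "Suc n"]
        adapted_compose[OF adapted_emp_mean F]) auto
  moreover have "(\<lambda>\<omega>. pulls a n \<omega> *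
      ((if real (pull_count \<omega> n a) = real m then 1 else 0) * F (emp_mean \<omega> n a))) =
      (\<lambda>\<omega>. if pulled_arm \<omega> (Suc n) = a \<and> pull_count \<omega> n a = m then F (emp_mean \<omega> n a) else 0)"
    by (auto simp: pulls_def)
  ultimately show ?thesis by simp
qed

text \<open>Each exponential, summed over rounds, has expectation at most 1, so a mixture costs at
  most its total weight. One exponential gives a Chernoff bound; infinitely many are needed to
  dominate the exponential of a square.\<close>

lemma nn_integral_at_pull_count:
  fixes F :: "real \<Rightarrow> ennreal" and w l :: "nat \<Rightarrow> real"
  assumes a: "a \<in> {1..K}" and w: "\<And>k. w k \<ge> 0"
    and F: "\<And>x. F x \<le> (\<Sum>k. ennreal (w k *
      exp (l k * (real m * (x - arm_mean \<nu> a)) - (l k)\<^sup>2 * \<sigma>\<^sup>2 * real m / 2)))"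
  shows "(\<integral>\<^sup>+\<omega>. (\<Sum>n<T. if pulled_arm \<omega> (Suc n) = a \<and> pull_count \<omega> n a = m
            then F (emp_mean \<omega> n a) else 0) \<partial>law) \<le> (\<Sum>k. ennreal (w k))"
proof -
  have m: "exp_at a m (l k) n \<in> borel_measurable law" for k n
    unfolding exp_at_def[OF a, abs_def]
    by (rule adapted_law[OF adapted_pulls_at]) measurable
  have "(\<integral>\<^sup>+\<omega>. (\<Sum>n<T. if pulled_arm \<omega> (Suc n) = a \<and> pull_count \<omega> n a = m
            then F (emp_mean \<omega> n a) else 0) \<partial>law) \<le>
      (\<integral>\<^sup>+\<omega>. (\<Sum>k. ennreal (w k) * (\<Sum>n<T. exp_at a m (l k) n \<omega>)) \<partial>law)"
  proof (intro nn_integral_mono)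
    fix \<omega>
    have "(\<Sum>n<T. if pulled_arm \<omega> (Suc n) = a \<and> pull_count \<omega> n a = m
            then F (emp_mean \<omega> n a) else 0) \<le> (\<Sum>n<T. \<Sum>k. ennreal (w k) * exp_at a m (l k) n \<omega>)"
      using F w by (intro sum_mono) (auto simp: exp_at_def[OF a] ennreal_mult')
    also have "\<dots> = (\<Sum>k. \<Sum>n<T. ennreal (w k) * exp_at a m (l k) n \<omega>)"
      by (intro suminf_sum[symmetric]) auto
    finally show "(\<Sum>n<T. if pulled_arm \<omega> (Suc n) = a \<and> pull_count \<omega> n a = m
            then F (emp_mean \<omega> n a) else 0) \<le> (\<Sum>k. ennreal (w k) * (\<Sum>n<T. exp_at a m (l k) n \<omega>))"
      by (simp add: sum_distrib_left)
  qed
  also have "\<dots> = (\<Sum>k. ennreal (w k) * (\<integral>\<^sup>+\<omega>. (\<Sum>n<T. exp_at a m (l k) n \<omega>) \<partial>law))"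
    using m by (simp add: nn_integral_suminf nn_integral_cmult borel_measurable_sum)
  also have "\<dots> \<le> (\<Sum>k. ennreal (w k) * 1)"
    by (intro suminf_le mult_left_mono nn_integral_sum_exp_at[OF a]) auto
  finally show ?thesis by simp
qed


section \<open>Counting the pulls of a suboptimal arm\<close>

definition best_emp_mean :: "nat \<Rightarrow> trajectory \<Rightarrow> real" where
  "best_emp_mean n \<omega> = (MAX b\<in>{1..K}. emp_mean \<omega> n b)"

lemma emp_gap_eq: "emp_gap K \<omega> n a = best_emp_mean n \<omega> - emp_mean \<omega> n a"
  by (simp add: emp_gap_def best_emp_mean_def)

lemma adapted_best_emp_mean: "adapted n (best_emp_mean n)"
  unfolding adapted_def
proof (intro conjI allI impI)
  show "best_emp_mean n \<in> borel_measurable (hist n)"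
    unfolding best_emp_mean_def[abs_def] by (intro borel_measurable_Max measurable_emp_mean) auto
  show "best_emp_mean n \<omega> = best_emp_mean n \<omega>'" if "\<forall>i<n. \<omega> i = \<omega>' i" for \<omega> \<omega>'
    by (simp add: best_emp_mean_def history_cong(2)[OF that])
qed

lemma emp_mean_le_best: "b \<in> {1..K} \<Longrightarrow> emp_mean \<omega> n b \<le> best_emp_mean n \<omega>"
  unfolding best_emp_mean_def by (intro Max_ge) auto

definition inverse_weight :: "nat \<Rightarrow> nat \<Rightarrow> trajectory \<Rightarrow> real" where
  "inverse_weight b n \<omega> = exp (real (pull_count \<omega> n b) * (emp_gap K \<omega> n b)\<^sup>2 / (2 * \<sigma>\<^sup>2))"

lemma inverse_weight_ms_weight: "inverse_weight b n \<omega> * ms_weight K \<sigma> \<omega> n b = 1"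
  by (simp add: inverse_weight_def ms_weight_def exp_add[symmetric])

lemma adapted_inverse_weight: "adapted n (inverse_weight b n)"
  unfolding adapted_def
proof (intro conjI allI impI)
  have [measurable]: "(\<lambda>\<omega>. real (pull_count \<omega> n b)) \<in> borel_measurable (hist n)"
    "(\<lambda>\<omega>. emp_gap K \<omega> n b) \<in> borel_measurable (hist n)"
    using adapted_pull_count adapted_emp_gap by (auto simp: adapted_def)
  show "inverse_weight b n \<in> borel_measurable (hist n)"
    unfolding inverse_weight_def[abs_def] by measurable
  show "inverse_weight b n \<omega> = inverse_weight b n \<omega>'" if "\<forall>i<n. \<omega> i = \<omega>' i" for \<omega> \<omega>'
    by (simp add: inverse_weight_def history_cong(1)[OF that] emp_gap_cong[OF that])
qed

text \<open>The empirically best arm has empirical gap 0 and hence weight 1.\<close>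

lemma one_le_sum_ms_weight: "1 \<le> (\<Sum>b\<in>{1..K}. ms_weight K \<sigma> \<omega> n b)"
proof -
  have "(MAX b\<in>{1..K}. emp_mean \<omega> n b) \<in> (\<lambda>b. emp_mean \<omega> n b) ` {1..K}"
    using K_ge1 by (intro Max_in) auto
  then obtain b where b: "b \<in> {1..K}" "emp_gap K \<omega> n b = 0" by (auto simp: emp_gap_def)
  then have "1 = ms_weight K \<sigma> \<omega> n b" by (simp add: ms_weight_def)
  also have "\<dots> \<le> (\<Sum>b\<in>{1..K}. ms_weight K \<sigma> \<omega> n b)"
    using b by (intro member_le_sum) (auto simp: ms_weight_def)
  finally show ?thesis .
qed

lemma policy_le_ms_weight: "K \<le> n \<Longrightarrow> \<pi> (Suc n) \<omega> a \<le> ms_weight K \<sigma> \<omega> n a"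
  using one_le_sum_ms_weight[of \<omega> n]
  by (simp add: maillard_sampling_def divide_le_eq ms_weight_def mult_le_cancel_left1)

text \<open>The weight of \<open>a\<close> is at most 1, so its probability is at most the
  reciprocal of the normalizer, and that equals the probability of \<open>b\<close> divided by the
  weight of \<open>b\<close>.\<close>

lemma policy_le_inverse_weight:
  assumes "K \<le> n"
  shows "\<pi> (Suc n) \<omega> a \<le> inverse_weight b n \<omega> * \<pi> (Suc n) \<omega> b"
proof -
  let ?S = "\<Sum>b\<in>{1..K}. ms_weight K \<sigma> \<omega> n b"
  have "ms_weight K \<sigma> \<omega> n a \<le> 1" by (simp add: ms_weight_def)
  then have "\<pi> (Suc n) \<omega> a \<le> 1 / ?S"
    using assms one_le_sum_ms_weight[of \<omega> n]
    by (simp add: maillard_sampling_def divide_right_mono)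
  also have "\<dots> = inverse_weight b n \<omega> * \<pi> (Suc n) \<omega> b"
    using assms by (simp add: maillard_sampling_def inverse_weight_ms_weight)
  finally show ?thesis .
qed

section \<open>Sums over pulls and the cost of wrong empirical means\<close>

lemma sum_pulls_below:
  "(\<Sum>n<T. if pulled_arm \<omega> (Suc n) = a \<and> pull_count \<omega> n a < u then 1 else 0 :: ennreal) \<le> of_nat u"
proof -
  have "(\<Sum>n<T. if pulled_arm \<omega> (Suc n) = a \<and> pull_count \<omega> n a < u then 1 else 0 :: ennreal) =
      of_nat (min u (pull_count \<omega> T a))"
  proof (induction T)
    case (Suc T)
    have "min u (pull_count \<omega> (Suc T) a) = min u (pull_count \<omega> T a) +
        (if pulled_arm \<omega> (Suc T) = a \<and> pull_count \<omega> T a < u then 1 else 0)"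
      by (auto simp: pull_count_Suc)
    then show ?case by (simp add: Suc)
  qed simp
  then show ?thesis by (simp only: of_nat_mono min.cobounded1)
qed

text \<open>Sorts the pulls by the earlier pull count. The range \<open>m < T\<close> suffices since
  at most \<open>n\<close> pulls precede round \<open>Suc n\<close>.\<close>

lemma sum_pulls_split:
  fixes F :: "nat \<Rightarrow> real \<Rightarrow> ennreal"
  shows "(\<Sum>n<T. pulls a n \<omega> * F (pull_count \<omega> n a) (emp_mean \<omega> n a)) =
    (\<Sum>m<T. \<Sum>n<T. if pulled_arm \<omega> (Suc n) = a \<and> pull_count \<omega> n a = m
       then F m (emp_mean \<omega> n a) else 0)"
proof (subst sum.swap, intro sum.cong refl)
  fix n assume "n \<in> {..<T}"
  then have "pull_count \<omega> n a < T" using pull_count_le[of \<omega> n a] by simp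
  then show "pulls a n \<omega> * F (pull_count \<omega> n a) (emp_mean \<omega> n a) =
     (\<Sum>m<T. if pulled_arm \<omega> (Suc n) = a \<and> pull_count \<omega> n a = m then F m (emp_mean \<omega> n a) else 0)"
    by (cases "pulled_arm \<omega> (Suc n) = a") (simp_all add: pulls_def sum.delta')
qed

lemma nn_integral_sum_pulls_split:
  fixes F :: "nat \<Rightarrow> real \<Rightarrow> ennreal"
  assumes "\<And>m. F m \<in> borel_measurable borel"
  shows "(\<integral>\<^sup>+\<omega>. (\<Sum>n<T. pulls a n \<omega> * F (pull_count \<omega> n a) (emp_mean \<omega> n a)) \<partial>law) =
    (\<Sum>m<T. \<integral>\<^sup>+\<omega>. (\<Sum>n<T. if pulled_arm \<omega> (Suc n) = a \<and> pull_count \<omega> n a = m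
       then F m (emp_mean \<omega> n a) else 0) \<partial>law)"
  unfolding sum_pulls_split
  by (intro nn_integral_sum borel_measurable_sum adapted_law[OF adapted_pulls_at] assms)

text \<open>For each pull count \<open>m\<close>, Chernoff's bound gives \<open>exp (-
  (\<epsilon>\<^sup>2 / (2 * \<sigma>\<^sup>2) * real m))\<close>; these terms form a geometric
  series.\<close>

lemma nn_integral_overestimated_pulls:
  assumes a: "a \<in> {1..K}" and \<epsilon>: "\<epsilon> > 0"
  shows "(\<integral>\<^sup>+\<omega>. (\<Sum>n<T. pulls a n \<omega> * (if emp_mean \<omega> n a \<ge> arm_mean \<nu> a + \<epsilon> then 1 else 0)) \<partial>law)
    \<le> ennreal (1 + 2 * \<sigma>\<^sup>2 / \<epsilon>\<^sup>2)"
proof -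
  let ?F = "\<lambda>(m::nat) x. if x \<ge> arm_mean \<nu> a + \<epsilon> then 1 else 0 :: ennreal"
  let ?q = "\<epsilon>\<^sup>2 / (2 * \<sigma>\<^sup>2)"
  have q: "?q > 0" using \<epsilon> sigma_pos by simp
  have "(\<integral>\<^sup>+\<omega>. (\<Sum>n<T. pulls a n \<omega> * (if emp_mean \<omega> n a \<ge> arm_mean \<nu> a + \<epsilon> then 1 else 0)) \<partial>law) =
     (\<Sum>m<T. \<integral>\<^sup>+\<omega>. (\<Sum>n<T. if pulled_arm \<omega> (Suc n) = a \<and> pull_count \<omega> n a = m
       then ?F m (emp_mean \<omega> n a) else 0) \<partial>law)"
    by (rule nn_integral_sum_pulls_split) measurable
  also have "\<dots> \<le> (\<Sum>m<T. ennreal (exp (- (?q * real m))))"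
  proof (intro sum_mono)
    fix m
    let ?w = "\<lambda>k::nat. if k = 0 then exp (- (?q * real m)) else 0"
    have suminf: "(\<Sum>k. ennreal (?w k * f k)) = ennreal (exp (- (?q * real m)) * f 0)" for f
      by (subst suminf_finite[of "{0}"]) auto
    have "(\<integral>\<^sup>+\<omega>. (\<Sum>n<T. if pulled_arm \<omega> (Suc n) = a \<and> pull_count \<omega> n a = m
       then ?F m (emp_mean \<omega> n a) else 0) \<partial>law) \<le> (\<Sum>k. ennreal (?w k))"
    \<comment> \<open>The choice \<open>\<epsilon> / \<sigma>\<^sup>2\<close> maximizes
      \<open>l * \<epsilon> - l\<^sup>2 * \<sigma>\<^sup>2 / 2\<close>, with maximum
      \<open>?q\<close>; the weights \<open>?w\<close> keep only this single exponential.\<close>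
    proof (rule nn_integral_at_pull_count[OF a, where l = "\<lambda>_. \<epsilon> / \<sigma>\<^sup>2"])
      fix x
      show "?F m x \<le> (\<Sum>k. ennreal (?w k * exp (\<epsilon> / \<sigma>\<^sup>2 * (real m * (x - arm_mean \<nu> a))
          - (\<epsilon> / \<sigma>\<^sup>2)\<^sup>2 * \<sigma>\<^sup>2 * real m / 2)))"
      proof (cases "x \<ge> arm_mean \<nu> a + \<epsilon>")
        case True
        then have "\<epsilon> / \<sigma>\<^sup>2 * (real m * \<epsilon>) \<le> \<epsilon> / \<sigma>\<^sup>2 * (real m * (x - arm_mean \<nu> a))"
          using \<epsilon> by (intro mult_left_mono) auto
        moreover have "\<epsilon> / \<sigma>\<^sup>2 * (real m * \<epsilon>) - (\<epsilon> / \<sigma>\<^sup>2)\<^sup>2 * \<sigma>\<^sup>2 * real m / 2 = ?q * real m"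
          using sigma_pos by (simp add: field_simps power2_eq_square)
        ultimately have "0 \<le> - (?q * real m) + (\<epsilon> / \<sigma>\<^sup>2 * (real m * (x - arm_mean \<nu> a))
          - (\<epsilon> / \<sigma>\<^sup>2)\<^sup>2 * \<sigma>\<^sup>2 * real m / 2)"
          by linarith
        with True show ?thesis
          unfolding suminf exp_add[symmetric] by (simp only: if_True one_le_exp_iff ennreal_ge_1)
      qed simp
    qed auto
    also have "\<dots> = ennreal (exp (- (?q * real m)))" using suminf[of "\<lambda>_. 1"] by simp
    finally show "(\<integral>\<^sup>+\<omega>. (\<Sum>n<T. if pulled_arm \<omega> (Suc n) = a \<and> pull_count \<omega> n a = m
       then ?F m (emp_mean \<omega> n a) else 0) \<partial>law) \<le> ennreal (exp (- (?q * real m)))" .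
  qed
  also have "\<dots> = ennreal (\<Sum>m<T. exp (- (?q * real m)))" by (rule sum_ennreal) simp
  also have "\<dots> \<le> ennreal (1 + 1 / ?q)" by (intro ennreal_leI sum_exp_geometric_le q)
  finally show ?thesis by simp
qed

text \<open>With shortfall \<open>y\<close> below the shifted mean, the exponent
  \<open>m * y\<^sup>2 / (2 * \<sigma>\<^sup>2)\<close> is beaten by the Gaussian tail at
  \<open>y + \<epsilon>\<close>. The layers make this precise for each \<open>m\<close>, and their
  totals sum over \<open>m\<close> to a logarithm.\<close>

lemma nn_integral_underestimated_pulls:
  assumes b: "b \<in> {1..K}" and \<epsilon>: "\<epsilon> > 0"
  shows "(\<integral>\<^sup>+\<omega>. (\<Sum>n<T. pulls b n \<omega> *
      (if emp_mean \<omega> n b \<le> arm_mean \<nu> b - \<epsilon>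
       then ennreal (exp (real (pull_count \<omega> n b) * (arm_mean \<nu> b - \<epsilon> - emp_mean \<omega> n b)\<^sup>2 / (2 * \<sigma>\<^sup>2)))
       else 0)) \<partial>law)
    \<le> ennreal (1 + 4 * \<sigma>\<^sup>2 / \<epsilon>\<^sup>2 * ln (1 + 8 * \<sigma>\<^sup>2 / \<epsilon>\<^sup>2))"
proof -
  let ?F = "\<lambda>(m::nat) x. if x \<le> arm_mean \<nu> b - \<epsilon>
     then ennreal (exp (real m * (arm_mean \<nu> b - \<epsilon> - x)\<^sup>2 / (2 * \<sigma>\<^sup>2))) else 0"
  let ?I = "\<lambda>m. \<integral>\<^sup>+\<omega>. (\<Sum>n<T. if pulled_arm \<omega> (Suc n) = b \<and> pull_count \<omega> n b = m
       then ?F m (emp_mean \<omega> n b) else 0) \<partial>law"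
  let ?q = "\<epsilon>\<^sup>2 / (8 * \<sigma>\<^sup>2)"
  have q: "?q > 0" using \<epsilon> sigma_pos by simp
  have zero: "?I 0 \<le> 1"
  proof -
    \<comment> \<open>With \<open>m = 0\<close> the empirical mean is the junk value \<open>0 / 0\<close>, but it is multiplied by \<open>m\<close>.\<close>
    let ?w = "\<lambda>k::nat. if k = 0 then 1 else 0 :: real"
    have suminf: "(\<Sum>k. ennreal (?w k * f k)) = ennreal (f 0)" for f
      by (subst suminf_finite[of "{0}"]) auto
    have "?I 0 \<le> (\<Sum>k. ennreal (?w k))"
      by (rule nn_integral_at_pull_count[OF b, where l = "\<lambda>_. 0"])
        (simp_all add: suminf[of "\<lambda>_. 1", simplified])
    then show ?thesis using suminf[of "\<lambda>_. 1"] by simp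
  qed
  \<comment> \<open>The total layer weight has \<open>m\<close> in its denominator, hence the
    restriction to \<open>m \<ge> 1\<close>.\<close>
  have pos: "?I m \<le> ennreal (1 / (2 * ?q) * (exp (- (?q * real m)) / real m))" if "m \<ge> 1" for m
  proof -
    have "?I m \<le> (\<Sum>k. ennreal (exp (- (real (2 * k + 3) * (?q * real m)))))"
    proof (rule nn_integral_at_pull_count[OF b, where l = "\<lambda>k. - ((real k / 2 + 1) * \<epsilon> / \<sigma>\<^sup>2)"])
      fix x
      show "?F m x \<le> (\<Sum>k. ennreal (exp (- (real (2 * k + 3) * (?q * real m))) *
         exp (- ((real k / 2 + 1) * \<epsilon> / \<sigma>\<^sup>2) * (real m * (x - arm_mean \<nu> b))
            - (- ((real k / 2 + 1) * \<epsilon> / \<sigma>\<^sup>2))\<^sup>2 * \<sigma>\<^sup>2 * real m / 2)))"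
      proof (cases "x \<le> arm_mean \<nu> b - \<epsilon>")
        case True
        have "x - arm_mean \<nu> b = - ((arm_mean \<nu> b - \<epsilon> - x) + \<epsilon>)" by simp
        with True exp_square_le_suminf[of "arm_mean \<nu> b - \<epsilon> - x" \<epsilon> \<sigma> m] \<epsilon> sigma_pos
        show ?thesis by (simp only: if_True)
      qed simp
    qed simp
    also have "\<dots> \<le> ennreal (exp (- (?q * real m)) / (2 * (?q * real m)))"
      using q that by (intro suminf_layer_weights_le mult_pos_pos) auto
    also have "exp (- (?q * real m)) / (2 * (?q * real m)) = 1 / (2 * ?q) * (exp (- (?q * real m)) / real m)"
      by (simp only: times_divide_times_eq mult_1_left mult.assoc)
    finally show ?thesis .
  qed
  have "(\<integral>\<^sup>+\<omega>. (\<Sum>n<T. pulls b n \<omega> * ?F (pull_count \<omega> n b) (emp_mean \<omega> n b)) \<partial>law) = (\<Sum>m<T. ?I m)"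
    by (rule nn_integral_sum_pulls_split) measurable
  \<comment> \<open>An inclusion of index sets only: for \<open>T = 0\<close> the index 0 is
    additional.\<close>
  also have "\<dots> \<le> (\<Sum>m\<in>insert 0 {1..<T}. ?I m)"
    by (intro sum_mono2) auto
  also have "\<dots> = ?I 0 + (\<Sum>m\<in>{1..<T}. ?I m)"
    by (subst sum.insert) auto
  also have "\<dots> \<le> 1 + (\<Sum>m\<in>{1..<T}. ennreal (1 / (2 * ?q) * (exp (- (?q * real m)) / real m)))"
    by (intro add_mono zero sum_mono pos) auto
  also have "\<dots> = ennreal (1 + 1 / (2 * ?q) * (\<Sum>m\<in>{1..<T}. exp (- (?q * real m)) / real m))"
    using q by (subst sum_ennreal) (auto simp: sum_distrib_left ennreal_plus sum_nonneg simp flip: ennreal_1)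
  also have "\<dots> \<le> ennreal (1 + 1 / (2 * ?q) * ln (1 + 1 / ?q))"
    using q by (intro ennreal_leI add_left_mono mult_left_mono sum_exp_over_le) auto
  also have "1 / (2 * ?q) * ln (1 + 1 / ?q) = 4 * \<sigma>\<^sup>2 / \<epsilon>\<^sup>2 * ln (1 + 8 * \<sigma>\<^sup>2 / \<epsilon>\<^sup>2)"
    by simp
  finally show ?thesis .
qed


section \<open>Decomposition of a round and the expected number of pulls\<close>

lemma measurable_pulls_below:
  "(\<lambda>\<omega>. if pulled_arm \<omega> (Suc n) = a \<and> pull_count \<omega> n a < u then 1 else 0 :: ennreal)
     \<in> borel_measurable law"
proof -
  have "adapted (Suc n) (\<lambda>\<omega>. pulls a n \<omega> * (if real (pull_count \<omega> n a) < u then 1 else 0))"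
    by (intro adapted_mult adapted_pulls adapted_mono[of n _ "Suc n"]
        adapted_compose[OF adapted_pull_count]) auto
  moreover have "(\<lambda>\<omega>. pulls a n \<omega> * (if real (pull_count \<omega> n a) < u then 1 else 0)) =
      (\<lambda>\<omega>. if pulled_arm \<omega> (Suc n) = a \<and> pull_count \<omega> n a < u then 1 else 0)"
    by (auto simp: pulls_def)
  ultimately show ?thesis by (simp add: adapted_law)
qed

text \<open>The case split of one round, with the threshold \<open>u\<close> and the probability
  \<open>p\<close> left open. The indicator of \<open>Suc n = a\<close> pays for the initial
  rounds.\<close>

lemma nn_integral_pulls_le:
  fixes u :: nat and d \<epsilon> p :: real
  assumes a: "a \<in> {1..K}" and b: "b \<in> {1..K}"
    and gap: "arm_mean \<nu> b - arm_mean \<nu> a = d + 2 * \<epsilon>" and d: "d > 0"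
    and p: "exp (- (real u * d\<^sup>2 / (2 * \<sigma>\<^sup>2))) \<le> p"
  shows "(\<integral>\<^sup>+\<omega>. pulls a n \<omega> \<partial>law) \<le> (if Suc n = a then 1 else 0) +
    (\<integral>\<^sup>+\<omega>. (if pulled_arm \<omega> (Suc n) = a \<and> pull_count \<omega> n a < u then 1 else 0) \<partial>law) + ennreal p +
    (\<integral>\<^sup>+\<omega>. pulls a n \<omega> * (if emp_mean \<omega> n a \<ge> arm_mean \<nu> a + \<epsilon> then 1 else 0) \<partial>law) +
    (\<integral>\<^sup>+\<omega>. pulls b n \<omega> *
      (if emp_mean \<omega> n b \<le> arm_mean \<nu> b - \<epsilon>
       then ennreal (exp (real (pull_count \<omega> n b) * (arm_mean \<nu> b - \<epsilon> - emp_mean \<omega> n b)\<^sup>2 / (2 * \<sigma>\<^sup>2)))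
       else 0) \<partial>law)"
    (is "_ \<le> ?one + ?few + ennreal p + ?over + ?under")
proof (cases "K \<le> n")
  case False
  \<comment> \<open>In the initial phase, round \<open>Suc n\<close> pulls arm \<open>Suc n\<close>
    with certainty.\<close>
  have "(\<integral>\<^sup>+\<omega>. pulls a n \<omega> \<partial>law) = (\<integral>\<^sup>+\<omega>. ennreal (\<pi> (Suc n) \<omega> a) \<partial>law)"
    using nn_integral_pulls[OF a adapted_const[of n 1]] by simp
  also have "\<dots> = ?one"
    using False by (simp add: maillard_sampling_def law.emeasure_space_1)
  finally show ?thesis by (simp add: add.assoc)
next
  case True
  let ?few' = "\<lambda>\<omega>. if pulled_arm \<omega> (Suc n) = a \<and> pull_count \<omega> n a < u then 1 else 0 :: ennreal"
  let ?many = "\<lambda>\<omega>. (if real (pull_count \<omega> n a) \<ge> u then 1 else 0) * (if emp_gap K \<omega> n a \<ge> d then 1 else 0 :: ennreal)"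
  let ?over' = "\<lambda>\<omega>. if emp_mean \<omega> n a \<ge> arm_mean \<nu> a + \<epsilon> then 1 else 0 :: ennreal"
  let ?low = "\<lambda>\<omega>. if best_emp_mean n \<omega> \<le> arm_mean \<nu> b - \<epsilon> then 1 else 0 :: ennreal"
  have "adapted n (\<lambda>\<omega>. if real (pull_count \<omega> n a) \<ge> u then 1 else 0 :: ennreal)"
    by (rule adapted_compose[OF adapted_pull_count]) measurable
  moreover have "adapted n (\<lambda>\<omega>. if emp_gap K \<omega> n a \<ge> d then 1 else 0 :: ennreal)"
    by (rule adapted_compose[OF adapted_emp_gap]) measurable
  ultimately have many: "adapted n ?many" by (rule adapted_mult)
  have over: "adapted n ?over'" by (rule adapted_compose[OF adapted_emp_mean]) measurable
  have low: "adapted n ?low" by (rule adapted_compose[OF adapted_best_emp_mean]) measurable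
  have adapted_low: "adapted n (\<lambda>\<omega>. ?low \<omega> * ennreal (inverse_weight b n \<omega>))"
    by (intro adapted_mult low adapted_compose[OF adapted_inverse_weight]) measurable
  have meas: "?many \<in> borel_measurable law" "?over' \<in> borel_measurable law"
    "?low \<in> borel_measurable law" "pulls a n \<in> borel_measurable law"
    by (rule adapted_law[OF many] adapted_law[OF over] adapted_law[OF low] adapted_law[OF adapted_pulls])+
  have meas_few: "?few' \<in> borel_measurable law"
    by (rule measurable_pulls_below)
  have pw: "pulls a n \<omega> \<le> ?few' \<omega> + ?many \<omega> * pulls a n \<omega> + pulls a n \<omega> * ?over' \<omega> + ?low \<omega> * pulls a n \<omega>" for \<omega>
  proof (cases "pulled_arm \<omega> (Suc n) = a \<and> \<not> pull_count \<omega> n a < u \<and>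
      \<not> emp_mean \<omega> n a \<ge> arm_mean \<nu> a + \<epsilon> \<and> \<not> best_emp_mean n \<omega> \<le> arm_mean \<nu> b - \<epsilon>")
    case True
    \<comment> \<open>Here the best empirical mean is above
      \<open>arm_mean \<nu> b - \<epsilon>\<close> and that of \<open>a\<close> is below
      \<open>arm_mean \<nu> a + \<epsilon>\<close>, so their difference exceeds the true gap minus
      \<open>2 * \<epsilon>\<close>, which is \<open>d\<close>.\<close>
    then have "emp_gap K \<omega> n a \<ge> d" using gap unfolding emp_gap_eq by linarith
    with True have "?many \<omega> * pulls a n \<omega> = 1" by (simp add: pulls_def)
    then show ?thesis by (simp add: pulls_def add.assoc add_increasing)
  next
    case False
    then show ?thesis by (auto simp: pulls_def add_increasing add_increasing2)
  qed
  have add4: "(\<integral>\<^sup>+\<omega>. A \<omega> + B \<omega> + C \<omega> + D \<omega> \<partial>law) =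
      (\<integral>\<^sup>+\<omega>. A \<omega> \<partial>law) + (\<integral>\<^sup>+\<omega>. B \<omega> \<partial>law) + (\<integral>\<^sup>+\<omega>. C \<omega> \<partial>law) + (\<integral>\<^sup>+\<omega>. D \<omega> \<partial>law)"
    if "A \<in> borel_measurable law" "B \<in> borel_measurable law" "C \<in> borel_measurable law"
      "D \<in> borel_measurable law" for A B C D :: "trajectory \<Rightarrow> ennreal"
    using that by (simp add: nn_integral_add)
  have "(\<integral>\<^sup>+\<omega>. pulls a n \<omega> \<partial>law) \<le>
      (\<integral>\<^sup>+\<omega>. ?few' \<omega> + ?many \<omega> * pulls a n \<omega> + pulls a n \<omega> * ?over' \<omega> + ?low \<omega> * pulls a n \<omega> \<partial>law)"
    by (intro nn_integral_mono pw)
  also have "\<dots> = ?few + (\<integral>\<^sup>+\<omega>. ?many \<omega> * pulls a n \<omega> \<partial>law) + ?over + (\<integral>\<^sup>+\<omega>. ?low \<omega> * pulls a n \<omega> \<partial>law)"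
    by (rule add4) (intro meas_few borel_measurable_times_ennreal[OF meas(1,4)]
        borel_measurable_times_ennreal[OF meas(4,2)] borel_measurable_times_ennreal[OF meas(3,4)])+
  also have "\<dots> \<le> ?few + ennreal p + ?over + ?under"
  proof (intro add_mono order_refl)
    have "(\<integral>\<^sup>+\<omega>. ?many \<omega> * pulls a n \<omega> \<partial>law) = (\<integral>\<^sup>+\<omega>. ?many \<omega> * ennreal (\<pi> (Suc n) \<omega> a) \<partial>law)"
      by (rule nn_integral_pulls[OF a many])
    also have "\<dots> \<le> (\<integral>\<^sup>+\<omega>. ennreal p \<partial>law)"
    proof (intro nn_integral_mono)
      fix \<omega>
      show "?many \<omega> * ennreal (\<pi> (Suc n) \<omega> a) \<le> ennreal p"
      proof (cases "real (pull_count \<omega> n a) \<ge> u \<and> emp_gap K \<omega> n a \<ge> d")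
        case ge: True
        have "\<pi> (Suc n) \<omega> a \<le> ms_weight K \<sigma> \<omega> n a" by (rule policy_le_ms_weight[OF True])
        also have "\<dots> \<le> exp (- (real u * d\<^sup>2 / (2 * \<sigma>\<^sup>2)))"
        proof -
          have "d\<^sup>2 \<le> (emp_gap K \<omega> n a)\<^sup>2" using ge d by (intro power_mono) auto
          then have "real u * d\<^sup>2 \<le> real (pull_count \<omega> n a) * (emp_gap K \<omega> n a)\<^sup>2"
            using ge by (intro mult_mono) auto
          then show ?thesis by (simp add: ms_weight_def divide_right_mono)
        qed
        also note p
        finally show ?thesis using ge by (simp add: ennreal_leI)
      qed auto
    qed
    finally show "(\<integral>\<^sup>+\<omega>. ?many \<omega> * pulls a n \<omega> \<partial>law) \<le> ennreal p"
      by (simp add: law.emeasure_space_1)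
    \<comment> \<open>The change of arms: pulls of \<open>a\<close> become probabilities of
      \<open>a\<close>, these are bounded by weighted probabilities of \<open>b\<close>, and those
      become pulls of \<open>b\<close> again. It works because \<open>?low\<close> and the inverse
      weight depend only on the history.\<close>
    have "(\<integral>\<^sup>+\<omega>. ?low \<omega> * pulls a n \<omega> \<partial>law) = (\<integral>\<^sup>+\<omega>. ?low \<omega> * ennreal (\<pi> (Suc n) \<omega> a) \<partial>law)"
      by (rule nn_integral_pulls[OF a low])
    also have "\<dots> \<le> (\<integral>\<^sup>+\<omega>. (?low \<omega> * ennreal (inverse_weight b n \<omega>)) * ennreal (\<pi> (Suc n) \<omega> b) \<partial>law)"
    proof (intro nn_integral_mono)
      fix \<omega>
      have "ennreal (\<pi> (Suc n) \<omega> a) \<le> ennreal (inverse_weight b n \<omega>) * ennreal (\<pi> (Suc n) \<omega> b)"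
        using policy_le_inverse_weight[OF True, of \<omega> a b]
        by (simp add: ennreal_leI inverse_weight_def maillard_sampling_nonneg flip: ennreal_mult)
      then show "?low \<omega> * ennreal (\<pi> (Suc n) \<omega> a) \<le>
          (?low \<omega> * ennreal (inverse_weight b n \<omega>)) * ennreal (\<pi> (Suc n) \<omega> b)"
        by (simp add: mult.assoc mult_left_mono)
    qed
    also have "\<dots> = (\<integral>\<^sup>+\<omega>. (?low \<omega> * ennreal (inverse_weight b n \<omega>)) * pulls b n \<omega> \<partial>law)"
      by (rule nn_integral_pulls[OF b adapted_low, symmetric])
    also have "\<dots> \<le> ?under"
    proof (intro nn_integral_mono)
      fix \<omega>
      show "?low \<omega> * ennreal (inverse_weight b n \<omega>) * pulls b n \<omega> \<le> pulls b n \<omega> *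
        (if emp_mean \<omega> n b \<le> arm_mean \<nu> b - \<epsilon>
         then ennreal (exp (real (pull_count \<omega> n b) * (arm_mean \<nu> b - \<epsilon> - emp_mean \<omega> n b)\<^sup>2 / (2 * \<sigma>\<^sup>2)))
         else 0)"
      proof (cases "best_emp_mean n \<omega> \<le> arm_mean \<nu> b - \<epsilon>")
        case le_best: True
        then have le: "emp_mean \<omega> n b \<le> arm_mean \<nu> b - \<epsilon>"
          using emp_mean_le_best[OF b, of \<omega> n] by simp
        \<comment> \<open>Since the best empirical mean is at most
          \<open>arm_mean \<nu> b - \<epsilon>\<close>, the empirical gap of \<open>b\<close> is at
          most its shortfall below that level.\<close>
        have "(emp_gap K \<omega> n b)\<^sup>2 \<le> (arm_mean \<nu> b - \<epsilon> - emp_mean \<omega> n b)\<^sup>2"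
          using le_best emp_mean_le_best[OF b, of \<omega> n] unfolding emp_gap_eq by (intro power_mono) auto
        then have "inverse_weight b n \<omega> \<le>
            exp (real (pull_count \<omega> n b) * (arm_mean \<nu> b - \<epsilon> - emp_mean \<omega> n b)\<^sup>2 / (2 * \<sigma>\<^sup>2))"
          by (simp add: inverse_weight_def divide_right_mono mult_left_mono)
        then show ?thesis using le_best le by (simp add: pulls_def ennreal_leI)
      qed simp
    qed
    finally show "(\<integral>\<^sup>+\<omega>. ?low \<omega> * pulls a n \<omega> \<partial>law) \<le> ?under" .
  qed
  finally show ?thesis by (simp add: add.assoc add_increasing)
qed


lemma nn_integral_sum_pulls_le:
  fixes u :: nat and d \<epsilon> p :: real
  assumes a: "a \<in> {1..K}" and b: "b \<in> {1..K}"
    and gap: "arm_mean \<nu> b - arm_mean \<nu> a = d + 2 * \<epsilon>" and d: "d > 0" and \<epsilon>: "\<epsilon> > 0"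
    and p: "exp (- (real u * d\<^sup>2 / (2 * \<sigma>\<^sup>2))) \<le> p"
  shows "(\<Sum>n<T. \<integral>\<^sup>+\<omega>. pulls a n \<omega> \<partial>law) \<le>
    ennreal (1 + real u + real T * p + (1 + 2 * \<sigma>\<^sup>2 / \<epsilon>\<^sup>2) + (1 + 4 * \<sigma>\<^sup>2 / \<epsilon>\<^sup>2 * ln (1 + 8 * \<sigma>\<^sup>2 / \<epsilon>\<^sup>2)))"
proof -
  let ?few = "\<lambda>n \<omega>. if pulled_arm \<omega> (Suc n) = a \<and> pull_count \<omega> n a < u then 1 else 0 :: ennreal"
  let ?over = "\<lambda>n \<omega>. pulls a n \<omega> * (if emp_mean \<omega> n a \<ge> arm_mean \<nu> a + \<epsilon> then 1 else 0)"
  let ?under = "\<lambda>n \<omega>. pulls b n \<omega> *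
      (if emp_mean \<omega> n b \<le> arm_mean \<nu> b - \<epsilon>
       then ennreal (exp (real (pull_count \<omega> n b) * (arm_mean \<nu> b - \<epsilon> - emp_mean \<omega> n b)\<^sup>2 / (2 * \<sigma>\<^sup>2)))
       else 0)"
  have few: "?few n \<in> borel_measurable law" for n
    by (rule measurable_pulls_below)
  have over: "?over n \<in> borel_measurable law" for n
    by (rule adapted_law[of "Suc n"], intro adapted_mult adapted_pulls adapted_mono[of n _ "Suc n"]
        adapted_compose[OF adapted_emp_mean]) auto
  have under: "?under n \<in> borel_measurable law" for n
  proof -
    have [measurable]: "(\<lambda>\<omega>. real (pull_count \<omega> n b)) \<in> borel_measurable law"
      "(\<lambda>\<omega>. emp_mean \<omega> n b) \<in> borel_measurable law" "pulls b n \<in> borel_measurable law"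
      by (rule adapted_law adapted_pull_count adapted_emp_mean adapted_pulls)+
    show ?thesis by measurable
  qed
  have p0: "p \<ge> 0" using p by (meson exp_ge_zero order_trans)
  have "(\<Sum>n<T. if Suc n = a then 1 else 0 :: ennreal) \<le> 1"
  proof -
    have "(\<Sum>n<T. if Suc n = a then 1 else 0 :: ennreal) = (\<Sum>n<T. if n = a - 1 then 1 else 0)"
      using a by (intro sum.cong) auto
    then show ?thesis by (simp add: sum.delta')
  qed
  then have one: "(\<Sum>n<T. if Suc n = a then 1 else 0 :: ennreal) \<le> ennreal 1" by simp
  have "(\<Sum>n<T. \<integral>\<^sup>+\<omega>. ?few n \<omega> \<partial>law) = (\<integral>\<^sup>+\<omega>. (\<Sum>n<T. ?few n \<omega>) \<partial>law)"
    by (rule nn_integral_sum[symmetric]) (rule few)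
  also have "\<dots> \<le> (\<integral>\<^sup>+\<omega>. of_nat u \<partial>law)"
    by (intro nn_integral_mono sum_pulls_below)
  finally have few_le: "(\<Sum>n<T. \<integral>\<^sup>+\<omega>. ?few n \<omega> \<partial>law) \<le> ennreal (real u)"
    by (simp add: law.emeasure_space_1 ennreal_of_nat_eq_real_of_nat)
  have "(\<Sum>n<T. \<integral>\<^sup>+\<omega>. ?over n \<omega> \<partial>law) = (\<integral>\<^sup>+\<omega>. (\<Sum>n<T. ?over n \<omega>) \<partial>law)"
    by (rule nn_integral_sum[symmetric]) (rule over)
  also note nn_integral_overestimated_pulls[OF a \<epsilon>]
  finally have over_le: "(\<Sum>n<T. \<integral>\<^sup>+\<omega>. ?over n \<omega> \<partial>law) \<le> ennreal (1 + 2 * \<sigma>\<^sup>2 / \<epsilon>\<^sup>2)" .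
  have "(\<Sum>n<T. \<integral>\<^sup>+\<omega>. ?under n \<omega> \<partial>law) = (\<integral>\<^sup>+\<omega>. (\<Sum>n<T. ?under n \<omega>) \<partial>law)"
    by (rule nn_integral_sum[symmetric]) (rule under)
  also note nn_integral_underestimated_pulls[OF b \<epsilon>]
  finally have under_le: "(\<Sum>n<T. \<integral>\<^sup>+\<omega>. ?under n \<omega> \<partial>law) \<le>
      ennreal (1 + 4 * \<sigma>\<^sup>2 / \<epsilon>\<^sup>2 * ln (1 + 8 * \<sigma>\<^sup>2 / \<epsilon>\<^sup>2))" .
  have p_eq: "(\<Sum>n<T. ennreal p) = ennreal (real T * p)"
    using p0 by (simp add: ennreal_mult' ennreal_of_nat_eq_real_of_nat)
  have "(\<Sum>n<T. \<integral>\<^sup>+\<omega>. pulls a n \<omega> \<partial>law) \<le> (\<Sum>n<T. (if Suc n = a then 1 else 0) +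
      (\<integral>\<^sup>+\<omega>. ?few n \<omega> \<partial>law) + ennreal p + (\<integral>\<^sup>+\<omega>. ?over n \<omega> \<partial>law) + (\<integral>\<^sup>+\<omega>. ?under n \<omega> \<partial>law))"
    by (intro sum_mono nn_integral_pulls_le[OF a b gap d p])
  also have "\<dots> = (\<Sum>n<T. if Suc n = a then 1 else 0) + (\<Sum>n<T. \<integral>\<^sup>+\<omega>. ?few n \<omega> \<partial>law) +
      (\<Sum>n<T. ennreal p) + (\<Sum>n<T. \<integral>\<^sup>+\<omega>. ?over n \<omega> \<partial>law) + (\<Sum>n<T. \<integral>\<^sup>+\<omega>. ?under n \<omega> \<partial>law)"
    by (simp only: sum.distrib)
  also have "\<dots> \<le> ennreal 1 + ennreal (real u) + ennreal (real T * p) +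
      ennreal (1 + 2 * \<sigma>\<^sup>2 / \<epsilon>\<^sup>2) + ennreal (1 + 4 * \<sigma>\<^sup>2 / \<epsilon>\<^sup>2 * ln (1 + 8 * \<sigma>\<^sup>2 / \<epsilon>\<^sup>2))"
    unfolding p_eq by (intro add_mono one few_le over_le under_le order_refl)
  also have "\<dots> = ennreal (1 + real u + real T * p + (1 + 2 * \<sigma>\<^sup>2 / \<epsilon>\<^sup>2) +
      (1 + 4 * \<sigma>\<^sup>2 / \<epsilon>\<^sup>2 * ln (1 + 8 * \<sigma>\<^sup>2 / \<epsilon>\<^sup>2)))"
  proof -
    have "0 \<le> real T * p" "0 \<le> 1 + 2 * \<sigma>\<^sup>2 / \<epsilon>\<^sup>2" using p0 by auto
    moreover have "0 \<le> 1 + 4 * \<sigma>\<^sup>2 / \<epsilon>\<^sup>2 * ln (1 + 8 * \<sigma>\<^sup>2 / \<epsilon>\<^sup>2)"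
      by (intro add_nonneg_nonneg mult_nonneg_nonneg ln_ge_zero) auto
    ultimately show ?thesis by (simp only: ennreal_plus add_nonneg_nonneg of_nat_0_le_iff zero_le_one)
  qed
  finally show ?thesis .
qed

lemma expected_pulls_le:
  fixes c :: real
  assumes a: "a \<in> {1..K}" and b: "b \<in> {1..K}" and T: "T \<ge> 1" and c: "c > 0"
    and \<Delta>_def: "\<Delta> = arm_mean \<nu> b - arm_mean \<nu> a" and \<Delta>: "\<Delta> > 0"
  defines "X \<equiv> (1 + c)\<^sup>2 * \<sigma>\<^sup>2 / (c\<^sup>2 * \<Delta>\<^sup>2)"
  shows "(\<Sum>n<T. \<integral>\<^sup>+\<omega>. pulls a n \<omega> \<partial>law) \<le>
    ennreal (2 * \<sigma>\<^sup>2 * (1 + c)\<^sup>2 * max 0 (ln (real T * \<Delta>\<^sup>2 / \<sigma>\<^sup>2)) / \<Delta>\<^sup>2 + 5000 * max 1 (X * ln X))"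
proof -
  \<comment> \<open>The part \<open>d\<close> of the gap sets the leading term and costs the factor
    \<open>(1 + c)\<^sup>2\<close>; the remainder \<open>c * \<Delta> / (1 + c)\<close> is halved
    between the deviations of \<open>a\<close> and \<open>b\<close>.\<close>
  define d where "d = \<Delta> / (1 + c)"
  define \<epsilon> where "\<epsilon> = c * \<Delta> / (1 + c) / 2"
  define z where "z = real T * \<Delta>\<^sup>2 / \<sigma>\<^sup>2"
  \<comment> \<open>Solves \<open>L * d\<^sup>2 / (2 * \<sigma>\<^sup>2) = max 0 (ln z)\<close>, so
    that after \<open>L\<close> pulls the weight is at most \<open>1 / z\<close>. The maximum keeps
    the threshold nonnegative when \<open>z < 1\<close>.\<close>
  define L where "L = 2 * \<sigma>\<^sup>2 * (1 + c)\<^sup>2 * max 0 (ln z) / \<Delta>\<^sup>2"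
  define u where "u = nat \<lceil>L\<rceil>"
  note \<sigma> = sigma_pos
  have pos: "d > 0" "\<epsilon> > 0" "z > 0" "X > 0" "L \<ge> 0"
    using c \<Delta> \<sigma> T by (simp_all add: d_def \<epsilon>_def z_def X_def L_def)
  have gap: "arm_mean \<nu> b - arm_mean \<nu> a = d + 2 * \<epsilon>"
  proof -
    have double: "2 * (x / 2) = x" for x :: real by simp
    have "d + 2 * \<epsilon> = \<Delta> / (1 + c) + c * \<Delta> / (1 + c)"
      unfolding d_def \<epsilon>_def by (simp only: double)
    also have "\<dots> = (1 + c) * \<Delta> / (1 + c)"
      by (simp only: distrib_right add_divide_distrib mult_1_left)
    finally show ?thesis using c by (simp add: \<Delta>_def)
  qed
  have u: "L \<le> real u" "real u \<le> L + 1"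
    using pos by (auto simp: u_def of_nat_nat)
  have "exp (- (real u * d\<^sup>2 / (2 * \<sigma>\<^sup>2))) \<le> exp (- (L * d\<^sup>2 / (2 * \<sigma>\<^sup>2)))"
    using u by (simp add: divide_right_mono mult_right_mono)
  also have "L * d\<^sup>2 / (2 * \<sigma>\<^sup>2) = max 0 (ln z)"
    using c \<Delta> \<sigma> by (simp add: L_def d_def power_divide)
  also have "exp (- max 0 (ln z)) \<le> exp (- ln z)" by simp
  also have "\<dots> = 1 / z" using pos by (simp add: exp_minus field_simps)
  finally have p: "exp (- (real u * d\<^sup>2 / (2 * \<sigma>\<^sup>2))) \<le> 1 / z" .
  \<comment> \<open>Over \<open>T\<close> rounds the probability \<open>1 / z\<close> adds up to
    \<open>\<sigma>\<^sup>2 / \<Delta>\<^sup>2\<close>, which is at most \<open>X\<close> because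
    \<open>(1 + c) / c \<ge> 1\<close>.\<close>
  have "1 * \<sigma>\<^sup>2 / \<Delta>\<^sup>2 \<le> ((1 + c) / c)\<^sup>2 * \<sigma>\<^sup>2 / \<Delta>\<^sup>2"
    using c by (intro divide_right_mono mult_right_mono one_le_power) auto
  then have Tz: "real T * (1 / z) \<le> X"
    using T \<Delta> \<sigma> by (simp add: z_def X_def power_divide)
  have \<epsilon>X: "\<sigma>\<^sup>2 / \<epsilon>\<^sup>2 = 4 * X"
  proof -
    have "\<epsilon>\<^sup>2 = c\<^sup>2 * \<Delta>\<^sup>2 / (1 + c)\<^sup>2 / 4"
      unfolding \<epsilon>_def power_divide power_mult_distrib by simp
    then show ?thesis by (simp add: X_def)
  qed
  have eq: "2 * \<sigma>\<^sup>2 / \<epsilon>\<^sup>2 = 8 * X" "4 * \<sigma>\<^sup>2 / \<epsilon>\<^sup>2 = 16 * X" "8 * \<sigma>\<^sup>2 / \<epsilon>\<^sup>2 = 32 * X"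
    using \<epsilon>X by simp_all
  have "(\<Sum>n<T. \<integral>\<^sup>+\<omega>. pulls a n \<omega> \<partial>law) \<le> ennreal (1 + real u + real T * (1 / z) +
      (1 + 2 * \<sigma>\<^sup>2 / \<epsilon>\<^sup>2) + (1 + 4 * \<sigma>\<^sup>2 / \<epsilon>\<^sup>2 * ln (1 + 8 * \<sigma>\<^sup>2 / \<epsilon>\<^sup>2)))"
    by (rule nn_integral_sum_pulls_le[OF a b gap pos(1,2) p])
  \<comment> \<open>The summands are at most 1, \<open>L + 1\<close>, \<open>X\<close>,
    \<open>1 + 8 * X\<close> and \<open>1 + 16 * X * ln (1 + 32 * X)\<close>; apart from
    \<open>L\<close> they form the left side of \<open>log_terms_le\<close>.\<close>
  also have "\<dots> \<le> ennreal (L + 5000 * max 1 (X * ln X))"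
    unfolding eq using u(2) Tz log_terms_le[OF pos(4)] by (intro ennreal_leI) linarith
  finally show ?thesis by (simp add: L_def z_def)
qed

section \<open>From expected pulls to expected regret\<close>

lemma nn_integral_regret:
  assumes nonneg: "\<And>a. a \<in> {1..K} \<Longrightarrow> gap K \<nu> a \<ge> 0"
  shows "(\<integral>\<^sup>+\<omega>. ennreal (regret K \<nu> T \<omega>) \<partial>law) =
    (\<Sum>a\<in>{a\<in>{1..K}. gap K \<nu> a > 0}. ennreal (gap K \<nu> a) * (\<Sum>n<T. \<integral>\<^sup>+\<omega>. pulls a n \<omega> \<partial>law))"
proof -
  let ?A = "{a\<in>{1..K}. gap K \<nu> a > 0}"
  have m: "pulls a n \<in> borel_measurable law" for a n by (rule adapted_law[OF adapted_pulls])
  have "(\<integral>\<^sup>+\<omega>. ennreal (regret K \<nu> T \<omega>) \<partial>law) =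
      (\<integral>\<^sup>+\<omega>. (\<Sum>a\<in>?A. ennreal (gap K \<nu> a) * (\<Sum>n<T. pulls a n \<omega>)) \<partial>law)"
  proof (intro nn_integral_cong)
    fix \<omega> assume \<omega>: "\<omega> \<in> space law"
    have "ennreal (regret K \<nu> T \<omega>) = ennreal (\<Sum>n<T. gap K \<nu> (pulled_arm \<omega> (Suc n)))"
      unfolding regret_def gap_def by (simp add: sum.atLeast1_atMost_eq)
    also have "\<dots> = (\<Sum>n<T. ennreal (gap K \<nu> (pulled_arm \<omega> (Suc n))))"
      using pulled_arm_space[OF \<omega>] nonneg by (intro sum_ennreal[symmetric]) auto
    also have "\<dots> = (\<Sum>n<T. \<Sum>a\<in>?A. ennreal (gap K \<nu> a) * pulls a n \<omega>)"
    proof (intro sum.cong refl)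
      fix n
      let ?i = "pulled_arm \<omega> (Suc n)"
      have i: "?i \<in> {1..K}" by (rule pulled_arm_space[OF \<omega>])
      have "(\<Sum>a\<in>?A. ennreal (gap K \<nu> a) * pulls a n \<omega>) =
          (\<Sum>a\<in>?A. if ?i = a then ennreal (gap K \<nu> a) else 0)"
        by (intro sum.cong refl) (simp add: pulls_def)
      also have "\<dots> = ennreal (gap K \<nu> ?i)"
        using i nonneg[OF i] by (simp add: sum.delta)
      finally show "ennreal (gap K \<nu> ?i) = (\<Sum>a\<in>?A. ennreal (gap K \<nu> a) * pulls a n \<omega>)" ..
    qed
    also have "\<dots> = (\<Sum>a\<in>?A. ennreal (gap K \<nu> a) * (\<Sum>n<T. pulls a n \<omega>))"
      by (subst sum.swap) (simp add: sum_distrib_left)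
    finally show "ennreal (regret K \<nu> T \<omega>) = (\<Sum>a\<in>?A. ennreal (gap K \<nu> a) * (\<Sum>n<T. pulls a n \<omega>))" .
  qed
  also have "\<dots> = (\<Sum>a\<in>?A. ennreal (gap K \<nu> a) * (\<Sum>n<T. \<integral>\<^sup>+\<omega>. pulls a n \<omega> \<partial>law))"
    using m by (simp add: nn_integral_sum nn_integral_cmult)
  finally show ?thesis .
qed

lemma expected_regret_le:
  fixes c :: real
  assumes T: "T \<ge> 1" and c: "c > 0"
  shows "(\<integral>\<omega>. regret K \<nu> T \<omega> \<partial>law) \<le>
    (\<Sum>a\<in>{a \<in> {1..K}. gap K \<nu> a > 0}.
      2 * \<sigma>\<^sup>2 * (1 + c)\<^sup>2 * max 0 (ln (real T * (gap K \<nu> a)\<^sup>2 / \<sigma>\<^sup>2)) / gap K \<nu> a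
      + 5000 * max (gap K \<nu> a)
          ((1 + c)\<^sup>2 * \<sigma>\<^sup>2 / (c\<^sup>2 * gap K \<nu> a)
            * ln ((1 + c)\<^sup>2 * \<sigma>\<^sup>2 / (c\<^sup>2 * (gap K \<nu> a)\<^sup>2))))"
    (is "_ \<le> (\<Sum>a\<in>?A. ?B a)")
proof -
  have "(MAX b\<in>{1..K}. arm_mean \<nu> b) \<in> arm_mean \<nu> ` {1..K}"
    using K_ge1 by (intro Max_in) auto
  then obtain b where b: "b \<in> {1..K}" and max: "(MAX b\<in>{1..K}. arm_mean \<nu> b) = arm_mean \<nu> b"
    by auto
  have gap_eq: "gap K \<nu> a = arm_mean \<nu> b - arm_mean \<nu> a" for a
    unfolding gap_def max ..
  have nonneg: "gap K \<nu> a \<ge> 0" if "a \<in> {1..K}" for a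
    unfolding gap_def using that by (simp add: Max_ge)
  \<comment> \<open>The last logarithm may be negative; the maximum with the positive gap keeps its
    summand nonnegative.\<close>
  have B0: "?B a \<ge> 0" if "a \<in> ?A" for a
    using that by (intro add_nonneg_nonneg divide_nonneg_nonneg mult_nonneg_nonneg) (auto simp: le_max_iff_disj)
  have reg0: "AE \<omega> in law. 0 \<le> regret K \<nu> T \<omega>"
    using nonneg pulled_arm_space unfolding regret_def gap_def by (intro AE_I2 sum_nonneg) auto
  \<comment> \<open>Integrability and nonnegativity of the regret turn its Bochner integral into a
    nonnegative one, where the pull counts are bounded.\<close>
  have "ennreal (\<integral>\<omega>. regret K \<nu> T \<omega> \<partial>law) = (\<integral>\<^sup>+\<omega>. ennreal (regret K \<nu> T \<omega>) \<partial>law)"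
    using integrable_regret[OF K_ge1 sub_gaussian_arms] reg0
    by (intro nn_integral_eq_integral[symmetric]) auto
  also have "\<dots> = (\<Sum>a\<in>?A. ennreal (gap K \<nu> a) * (\<Sum>n<T. \<integral>\<^sup>+\<omega>. pulls a n \<omega> \<partial>law))"
    by (rule nn_integral_regret[OF nonneg])
  also have "\<dots> \<le> (\<Sum>a\<in>?A. ennreal (?B a))"
  proof (intro sum_mono)
    fix a assume "a \<in> ?A"
    then have a: "a \<in> {1..K}" and \<Delta>: "gap K \<nu> a > 0" by auto
    let ?\<Delta> = "gap K \<nu> a"
    let ?X = "(1 + c)\<^sup>2 * \<sigma>\<^sup>2 / (c\<^sup>2 * ?\<Delta>\<^sup>2)"
    let ?L = "max 0 (ln (real T * ?\<Delta>\<^sup>2 / \<sigma>\<^sup>2))"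
    have "ennreal ?\<Delta> * (\<Sum>n<T. \<integral>\<^sup>+\<omega>. pulls a n \<omega> \<partial>law) \<le>
        ennreal ?\<Delta> * ennreal (2 * \<sigma>\<^sup>2 * (1 + c)\<^sup>2 * ?L / ?\<Delta>\<^sup>2 + 5000 * max 1 (?X * ln ?X))"
      by (intro mult_left_mono expected_pulls_le[OF a b T c gap_eq \<Delta>]) simp
    also have "\<dots> = ennreal (?\<Delta> * (2 * \<sigma>\<^sup>2 * (1 + c)\<^sup>2 * ?L / ?\<Delta>\<^sup>2 + 5000 * max 1 (?X * ln ?X)))"
      using \<Delta> by (simp only: ennreal_mult' less_imp_le)
    also have "?\<Delta> * (2 * \<sigma>\<^sup>2 * (1 + c)\<^sup>2 * ?L / ?\<Delta>\<^sup>2 + 5000 * max 1 (?X * ln ?X)) =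
        2 * \<sigma>\<^sup>2 * (1 + c)\<^sup>2 * ?L / ?\<Delta> + 5000 * (?\<Delta> * max 1 (?X * ln ?X))"
      using \<Delta> by (simp add: distrib_left power2_eq_square)
    also have "?\<Delta> * max 1 (?X * ln ?X) = max ?\<Delta> ((1 + c)\<^sup>2 * \<sigma>\<^sup>2 / (c\<^sup>2 * ?\<Delta>) * ln ?X)"
    proof -
      have "?\<Delta> * ?X = (1 + c)\<^sup>2 * \<sigma>\<^sup>2 / (c\<^sup>2 * ?\<Delta>)"
        using \<Delta> by (simp add: power2_eq_square mult.assoc)
      then show ?thesis
        using \<Delta> by (simp only: max_mult_distrib_left mult_1_right mult.assoc[symmetric] less_imp_le if_True)
    qed
    finally show "ennreal ?\<Delta> * (\<Sum>n<T. \<integral>\<^sup>+\<omega>. pulls a n \<omega> \<partial>law) \<le> ennreal (?B a)" .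
  qed
  also have "\<dots> = ennreal (\<Sum>a\<in>?A. ?B a)" by (rule sum_ennreal) (rule B0)
  finally show ?thesis
    using B0 by (subst (asm) ennreal_le_iff) (auto intro: sum_nonneg)
qed

end

text \<open>Quantifying \<open>C\<close> before the instance, the horizon and \<open>c\<close> makes
  the constant universal. The leading logarithm enters through its positive part, as it is negative
  when \<open>T * \<Delta>\<^sup>2 < \<sigma>\<^sup>2\<close>.\<close>

theorem theorem2:
  shows "\<exists>C::real. C > 0 \<and>
    (\<forall>(K::nat) (\<sigma>::real) (\<nu> :: nat \<Rightarrow> real measure) (T::nat) (c::real).
       K \<ge> 2 \<longrightarrow> \<sigma> > 0 \<longrightarrow> (\<forall>a\<in>{1..K}. sub_gaussian \<sigma> (\<nu> a)) \<longrightarrow> T \<ge> 1 \<longrightarrow> c > 0 \<longrightarrow>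
       (\<integral>\<omega>. regret K \<nu> T \<omega> \<partial>bandit_law K \<nu> (maillard_sampling K \<sigma>)) \<le>
       (\<Sum>a\<in>{a \<in> {1..K}. gap K \<nu> a > 0}.
          2 * \<sigma>\<^sup>2 * (1 + c)\<^sup>2 * max 0 (ln (real T * (gap K \<nu> a)\<^sup>2 / \<sigma>\<^sup>2)) / gap K \<nu> a
          + C * max (gap K \<nu> a)
              ((1 + c)\<^sup>2 * \<sigma>\<^sup>2 / (c\<^sup>2 * gap K \<nu> a)
                * ln ((1 + c)\<^sup>2 * \<sigma>\<^sup>2 / (c\<^sup>2 * (gap K \<nu> a)\<^sup>2)))))"
\<comment> \<open>The constant 5000 is the one from \<open>log_terms_le\<close>.\<close>
proof (intro exI[of _ 5000] conjI allI impI)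
  fix K :: nat and \<sigma> :: real and \<nu> :: "nat \<Rightarrow> real measure" and T :: nat and c :: real
  assume *: "K \<ge> 2" "\<sigma> > 0" "\<forall>a\<in>{1..K}. sub_gaussian \<sigma> (\<nu> a)" "T \<ge> 1" "c > 0"
  interpret maillard_bandit K \<sigma> \<nu> using * by unfold_locales auto
  show "(\<integral>\<omega>. regret K \<nu> T \<omega> \<partial>bandit_law K \<nu> (maillard_sampling K \<sigma>)) \<le>
       (\<Sum>a\<in>{a \<in> {1..K}. gap K \<nu> a > 0}.
          2 * \<sigma>\<^sup>2 * (1 + c)\<^sup>2 * max 0 (ln (real T * (gap K \<nu> a)\<^sup>2 / \<sigma>\<^sup>2)) / gap K \<nu> a
          + 5000 * max (gap K \<nu> a)
              ((1 + c)\<^sup>2 * \<sigma>\<^sup>2 / (c\<^sup>2 * gap K \<nu> a)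
                * ln ((1 + c)\<^sup>2 * \<sigma>\<^sup>2 / (c\<^sup>2 * (gap K \<nu> a)\<^sup>2))))"
    using expected_regret_le[OF *(4,5)] .
qed simp

end
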